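(* Let $d\ge 1$, let $\mu=(m_0,\dots,m_{2d-1})\in\mathbb{C}^{2d}$ be given, and let $r\leqslant d$ be the rank of the $d\times(d+1)$ Hankel matrix $\tilde M_d=(m_{i+j})_{0\le i\le d-1,\,0\le j\le d}$. Then the Prony problem of order $d$ with input $\mu$ is solvable if and only if the upper left $r\times r$ minor $|M_r|=\det (m_{i+j})_{0\le i,j\le r-1}$ of $\tilde M_d$ is non-zero. The solution, if it exists, is unique up to a permutation of the nodes $\{x_j\}$. The multiplicity vector $D=(d_1,\dots,d_s)$ of the resulting confluent Prony system has order $\sum_{j=1}^s d_j=r$ (so the solution has rank $r$), and it is the multiplicity vector of the poles of the rational function solving the diagonal Padé approximation problem with input $\mu$.
   Context: **Prony problem of order $d$.** Given $\mu=(m_0,\dots,m_{2d-1})\in\mathbb{C}^{2d}$, find a multiplicity vector $D=(d_1,\dots,d_s)$ of positive integers of order $\sum_{j=1}^s d_j\le d$, pairwise distinct nodes $x_1,\dots,x_s\in\mathbb{C}$ and coefficients $a_{j,\ell}\in\mathbb{C}$ ($1\le j\le s$, $0\le \ell\le d_j-1$), with $a_{j,d_j-1}\ne 0$ for all $j$, such that $$\sum_{j=1}^{s}\sum_{\ell=0}^{d_j-1} a_{j,\ell}\,\frac{k!}{(k-\ell)!}\,x_j^{k-\ell}=m_k,\qquad k=0,1,\dots,2d-1,$$ where $\frac{k!}{(k-\ell)!}x_j^{k-\ell}$ denotes the $\ell$-th derivative of $x^k$ at $x_j$ (so it is $0$ if $\ell>k$). This is the confluent Prony system with multiplicity vector $D$;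 the rank of a solution is $\sum_j d_j$. The zero signal ($s=0$, rank $0$) is allowed, and the empty minor is $|M_0|=1$. **Diagonal Padé approximation problem.** Given $\mu=(m_0,\dots,m_{2d-1})\in\mathbb{C}^{2d}$, find a rational function $R=P/Q$ with $\deg P<\deg Q\le d$ (the zero function being allowed) such that $R(z)=\sum_{k=0}^{2d-1} m_k z^{-k-1}+O(z^{-2d-1})$ as $z\to\infty$. *)

theory Defs
  imports "HOL-Complex_Analysis.Complex_Analysis" "HOL-Library.Landau_Symbols"
    "HOL-Combinatorics.Permutations"
    "Jordan_Normal_Form.Determinant" "Jordan_Normal_Form.DL_Rank"
begin

text \<open>An input \<open>\<mu> \<in> \<complex>\<^sup>2\<^sup>d\<close> is a sequence \<open>m :: nat \<Rightarrow> complex\<close> of which only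
  the entries with index below \<open>2 * d\<close> are ever used.\<close>

definition hankel :: "(nat \<Rightarrow> complex) \<Rightarrow> nat \<Rightarrow> nat \<Rightarrow> complex mat" where
  "hankel m nr nc = mat nr nc (\<lambda>(i, j). m (i + j))"

text \<open>The \<open>l\<close>-th derivative of \<open>x ^ k\<close>. The guard is needed because
  subtraction on \<open>nat\<close> truncates.\<close>

definition deriv_monom :: "nat \<Rightarrow> nat \<Rightarrow> complex \<Rightarrow> complex" where
  "deriv_monom k l x = (if l \<le> k then fact k / fact (k - l) * x ^ (k - l) else 0)"

text \<open>A signal consists of the number \<open>s\<close> of nodes, multiplicities \<open>D\<close>,
  nodes \<open>x\<close> and coefficients \<open>a\<close>. Nodes are indexed by \<open>0, \<dots>, s - 1\<close>; values of
  \<open>D\<close>, \<open>x\<close> at \<open>j \<ge> s\<close>, and of \<open>a j l\<close> at \<open>j \<ge> s\<close> or \<open>l \<ge> D j\<close>, are irrelevant.\<close>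

definition prony_solution ::
  "nat \<Rightarrow> (nat \<Rightarrow> complex) \<Rightarrow> nat \<Rightarrow> (nat \<Rightarrow> nat) \<Rightarrow> (nat \<Rightarrow> complex) \<Rightarrow>
    (nat \<Rightarrow> nat \<Rightarrow> complex) \<Rightarrow> bool" where
  "prony_solution d m s D x a \<longleftrightarrow>
     (\<forall>j<s. 0 < D j) \<and> (\<Sum>j<s. D j) \<le> d \<and>
     inj_on x {..<s} \<and>
     (\<forall>j<s. a j (D j - 1) \<noteq> 0) \<and>
     (\<forall>k<2 * d. (\<Sum>j<s. \<Sum>l<D j. a j l * deriv_monom k l (x j)) = m k)"

definition same_signal ::
  "nat \<Rightarrow> (nat \<Rightarrow> nat) \<Rightarrow> (nat \<Rightarrow> complex) \<Rightarrow> (nat \<Rightarrow> nat \<Rightarrow> complex) \<Rightarrow>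
   nat \<Rightarrow> (nat \<Rightarrow> nat) \<Rightarrow> (nat \<Rightarrow> complex) \<Rightarrow> (nat \<Rightarrow> nat \<Rightarrow> complex) \<Rightarrow> bool" where
  "same_signal s D x a s' D' x' a' \<longleftrightarrow>
     s' = s \<and>
     (\<exists>\<pi>. \<pi> permutes {..<s} \<and>
       (\<forall>j<s. D' (\<pi> j) = D j \<and> x' (\<pi> j) = x j \<and> (\<forall>l<D j. a' (\<pi> j) l = a j l)))"

definition rat_fun :: "complex poly \<Rightarrow> complex poly \<Rightarrow> complex \<Rightarrow> complex" where
  "rat_fun P Q z = poly P z / poly Q z"

text \<open>The rational function is given by a numerator and a denominator that need not
  be coprime; \<open>P / Q\<close> and \<open>P' / Q'\<close> are the same rational function iff
  \<open>P * Q' = P' * Q\<close>. The disjunct \<open>P = 0\<close> is the convention that the zero polynomial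
  has degree \<open>-\<infinity>\<close>.\<close>

definition pade_solution ::
  "nat \<Rightarrow> (nat \<Rightarrow> complex) \<Rightarrow> complex poly \<Rightarrow> complex poly \<Rightarrow> bool" where
  "pade_solution d m P Q \<longleftrightarrow>
     Q \<noteq> 0 \<and> (P = 0 \<or> degree P < degree Q) \<and> degree Q \<le> d \<and>
     (\<lambda>z. rat_fun P Q z - (\<Sum>k<2 * d. m k / z ^ (k + 1)))
       \<in> O[at_infinity](\<lambda>z. 1 / z ^ (2 * d + 1))"

text \<open>\<open>(D 0, \<dots>, D (s - 1))\<close> lists the orders of the distinct poles of \<open>f\<close>, for some
  enumeration \<open>p\<close> of these poles.\<close>

definition pole_multiplicity_vector ::
  "(complex \<Rightarrow> complex) \<Rightarrow> nat \<Rightarrow> (nat \<Rightarrow> nat) \<Rightarrow> bool" where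
  "pole_multiplicity_vector f s D \<longleftrightarrow>
     (\<exists>p. bij_betw p {..<s} {z. is_pole f z} \<and> (\<forall>j<s. zorder f (p j) = - int (D j)))"

end

theory Submission
  imports Defs "HOL-Computational_Algebra.Fundamental_Theorem_Algebra"
begin

text \<open>
Everything is read through two linear functionals on polynomials: the input gives
\<open>moment m\<close>, sending \<open>X ^ k\<close> to \<open>m k\<close>, and a signal gives \<open>eval_signal\<close>, sending
\<open>p\<close> to \<open>\<Sum>j l. a j l * ((pderiv ^^ l) p) (x j)\<close>.
A signal of order at most \<open>d\<close> with non-zero leading coefficients solves the Prony problem iff the
two functionals agree on polynomials of degree below \<open>2 * d\<close>. Its node polynomial
\<open>Q = \<Prod>j. (X - x j) ^ D j\<close> has the order \<open>R\<close> of the signal as its degree, and all multiples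
of \<open>Q\<close> are in the kernel of \<open>eval_signal\<close>.

A single computation (\<open>eval_signal_extract_coeff\<close>) is the engine of the algebraic part: a suitable
product of linear factors is a test polynomial on which the signal takes the value of one
coefficient times a non-zero constant. It shows that a signal with vanishing moments of index below
its order is zero (\<open>signal_coeffs_eq_0\<close>), which gives uniqueness, because the difference of
two solutions is a signal of order at most \<open>2 * d\<close>, and which also makes the confluent Vandermonde
system solvable (\<open>confluent_interpolation\<close>). With non-zero leading coefficients the test
polynomials also make the bilinear form \<open>(u, v) \<mapsto> eval_signal (u * v)\<close> nondegenerate on degrees below
\<open>R\<close> (\<open>eval_signal_nondegenerate\<close>); this form is the Hankel matrix \<open>M\<^sub>R\<close>, so \<open>|M\<^sub>R| \<noteq> 0\<close>. Reduction modulo \<open>Q\<close>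
writes every column of the \<open>d \<times> (d + 1)\<close> matrix in terms of the first \<open>R\<close>, so its rank is \<open>R\<close>.

Conversely, if the rank is \<open>r\<close> and \<open>|M\<^sub>r| \<noteq> 0\<close>, column \<open>r\<close> is a combination of the first \<open>r\<close>
columns. This is a monic \<open>q\<close> of degree \<open>r\<close> whose multiples \<open>X ^ i * q\<close> have zero moment for
\<open>i < d\<close>, and the rank condition on the remaining columns extends this to all \<open>i < 2 * d - r\<close>
(\<open>hankel_recurrence_exists\<close>). The roots of \<open>q\<close> are the nodes, interpolation gives the
coefficients, and division by \<open>q\<close> propagates the agreement from degrees below \<open>r\<close> to degrees
below \<open>2 * d\<close>. A vanishing leading coefficient would put a polynomial of degree \<open>r - 1\<close> into the
kernel of \<open>M\<^sub>r\<close>.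

For the rational function, the generating series of the \<open>l\<close>-th derivatives of \<open>x ^ k\<close> is
\<open>l! / (z - x) ^ (l + 1)\<close>. So \<open>\<Sum>j l. a j l * l! / (z - x j) ^ (l + 1)\<close>, with denominator \<open>Q\<close>, solves the
Pade problem; since the leading coefficients do not vanish, its pole at \<open>x j\<close> has order exactly
\<open>D j\<close>. Two Pade solutions agree because their difference, multiplied by both denominators, is a
polynomial that tends to \<open>0\<close> at infinity.
\<close>

section \<open>The moment functional\<close>

definition moment :: "(nat \<Rightarrow> complex) \<Rightarrow> complex poly \<Rightarrow> complex" where
  "moment m p = (\<Sum>k\<le>degree p. coeff p k * m k)"

lemma moment_eq_sum:
  assumes "\<And>k. k \<ge> n \<Longrightarrow> coeff p k = 0"
  shows "moment m p = (\<Sum>k<n. coeff p k * m k)"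
proof -
  have "moment m p = (\<Sum>k\<in>{..degree p} \<union> {..<n}. coeff p k * m k)"
    unfolding moment_def by (rule sum.mono_neutral_left) (auto simp: coeff_eq_0)
  also have "\<dots> = (\<Sum>k<n. coeff p k * m k)"
    by (rule sum.mono_neutral_right) (use assms in auto)
  finally show ?thesis .
qed

lemma moment_0 [simp]: "moment m 0 = 0"
  by (simp add: moment_def)

lemma moment_add: "moment m (p + q) = moment m p + moment m q"
proof -
  define n where "n = Suc (max (degree p) (degree q))"
  have "coeff p k = 0" "coeff q k = 0" "coeff (p + q) k = 0" if "k \<ge> n" for k
    using that by (auto simp: n_def coeff_eq_0)
  thus ?thesis
    by (simp add: moment_eq_sum[of n] ring_distribs sum.distrib)
qed

lemma moment_smult: "moment m (Polynomial.smult c p) = c * moment m p"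
  by (cases "c = 0") (simp_all add: moment_def sum_distrib_left mult.assoc)

lemma moment_diff: "moment m (p - q) = moment m p - moment m q"
  using moment_add[of m "p - q" q] by simp

lemma moment_sum: "moment m (\<Sum>i\<in>I. f i) = (\<Sum>i\<in>I. moment m (f i))"
  by (induction I rule: infinite_finite_induct) (simp_all add: moment_add)

lemma moment_monom [simp]: "moment m (monom c k) = c * m k"
  by (cases "c = 0") (simp_all add: moment_def degree_monom_eq if_distrib[of "\<lambda>x. x * _"] cong: if_cong)

lemma poly_eq_sum_monom:
  fixes p :: "complex poly"
  assumes "\<And>k. k \<ge> n \<Longrightarrow> coeff p k = 0"
  shows "p = (\<Sum>k<n. Polynomial.smult (coeff p k) (monom 1 k))"
  by (rule poly_eqI) (use assms in \<open>auto simp: coeff_sum smult_monom not_less\<close>)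

text \<open>The left-hand side is entry \<open>i\<close> of a Hankel matrix with \<open>n\<close> columns applied to the coefficient
  vector of \<open>v\<close>. This is how matrix statements about \<open>hankel\<close> become statements about polynomials.\<close>

lemma moment_monom_mult_eq_sum:
  assumes "\<And>k. k \<ge> n \<Longrightarrow> coeff v k = 0"
  shows "moment m (monom 1 i * v) = (\<Sum>j<n. m (i + j) * coeff v j)"
proof -
  have "monom 1 i * v = (\<Sum>k<n. Polynomial.smult (coeff v k) (monom 1 (i + k)))"
    by (subst poly_eq_sum_monom[OF assms]) (simp_all add: sum_distrib_left smult_monom mult_monom)
  thus ?thesis by (simp add: moment_sum moment_smult mult.commute)
qed

lemma degree_less_iff_coeff: 
  "p = 0 \<or> degree p < n \<longleftrightarrow> (\<forall>k\<ge>n. coeff p k = 0)"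
  by (metis coeff_eq_0 degree_0 leading_coeff_0_iff linorder_not_le not_gr_zero order_less_le_trans coeff_0)

section \<open>Confluent evaluation functionals\<close>

text \<open>Up to order \<open>n\<close>, the Taylor expansion of \<open>(X - y) ^ n * g\<close> at \<open>y\<close> only has the term
  \<open>g(y) * (X - y) ^ n\<close>. In the induction one derivative splits off a factor \<open>X - y\<close> and leaves a
  cofactor whose value at \<open>y\<close> is \<open>n * g(y)\<close>.\<close>

lemma poly_higher_pderiv_linear_power_mult:
  fixes y :: complex
  assumes "l \<le> n"
  shows "poly ((pderiv ^^ l) ([:-y, 1:] ^ n * g)) y = (if l = n then fact n * poly g y else 0)"
  using assms
proof (induction l arbitrary: n g)
  case 0
  thus ?case by auto
next
  case (Suc l)
  then obtain k where n: "n = Suc k" and k: "l \<le> k"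
    by (cases n) auto
  define L where "L = [:-y, 1:]"
  have L: "pderiv L = 1"
    by (simp add: L_def pderiv_pCons)
  have "pderiv (L ^ n * g) = L ^ n * pderiv g + g * Polynomial.smult (of_nat n) (L ^ k)"
    by (simp only: n pderiv_mult pderiv_power_Suc L mult_1_right)
  also have "\<dots> = L ^ k * (Polynomial.smult (of_nat n) g + L * pderiv g)"
    by (simp add: n algebra_simps)
  finally have "pderiv ([:-y, 1:] ^ n * g) = [:-y, 1:] ^ k * (Polynomial.smult (of_nat n) g + [:-y, 1:] * pderiv g)"
    by (simp only: L_def)
  hence "poly ((pderiv ^^ Suc l) ([:-y, 1:] ^ n * g)) y
      = poly ((pderiv ^^ l) ([:-y, 1:] ^ k * (Polynomial.smult (of_nat n) g + [:-y, 1:] * pderiv g))) y"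
    by (simp add: funpow_swap1)
  also have "\<dots> = (if Suc l = n then fact n * poly g y else 0)"
    by (subst Suc.IH[OF k]) (auto simp: n algebra_simps)
  finally show ?case .
qed

lemma poly_higher_pderiv_eq_0_of_dvd:
  fixes y :: complex
  assumes "[:-y, 1:] ^ n dvd p" "l < n"
  shows "poly ((pderiv ^^ l) p) y = 0"
  using assms poly_higher_pderiv_linear_power_mult[of l n y] by (auto elim!: dvdE)

lemma deriv_monom_eq: "deriv_monom k l x = poly ((pderiv ^^ l) (monom 1 k)) x"
proof -
  have *: "(pderiv ^^ l) (monom 1 k) = monom (fact k / fact (k - l) :: complex) (k - l)" if "l \<le> k" for l
    using that
  proof (induction l)
    case (Suc l)
    hence "k - l = Suc (k - Suc l)" by simp
    thus ?case using Suc by (simp add: pderiv_monom field_simps del: of_nat_Suc)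
  qed simp
  show ?thesis
  proof (cases "l \<le> k")
    case True
    thus ?thesis using *[of l] by (simp add: deriv_monom_def poly_monom)
  next
    case False
    hence "(pderiv ^^ l) (monom 1 k :: complex poly) = (pderiv ^^ (l - Suc k)) (pderiv ((pderiv ^^ k) (monom 1 k)))"
      by (metis add.commute add_Suc_right comp_apply funpow_add funpow.simps(2) le_add_diff_inverse not_less_eq_eq)
    also have "\<dots> = 0"
      using *[of k] by (simp add: pderiv_monom)
    finally show ?thesis using False by (simp add: deriv_monom_def)
  qed
qed

text \<open>The index set is arbitrary, because for uniqueness the nodes themselves serve as
  indices.\<close>

definition eval_signal ::
  "'i set \<Rightarrow> ('i \<Rightarrow> complex) \<Rightarrow> ('i \<Rightarrow> nat) \<Rightarrow> ('i \<Rightarrow> nat \<Rightarrow> complex) \<Rightarrow> complex poly \<Rightarrow> complex" where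
  "eval_signal J x N a p = (\<Sum>j\<in>J. \<Sum>l<N j. a j l * poly ((pderiv ^^ l) p) (x j))"

definition node_poly :: "'i set \<Rightarrow> ('i \<Rightarrow> complex) \<Rightarrow> ('i \<Rightarrow> nat) \<Rightarrow> complex poly" where
  "node_poly J x N = (\<Prod>j\<in>J. [:- x j, 1:] ^ N j)"

lemma eval_signal_0 [simp]: "eval_signal J x N a 0 = 0"
  by (simp add: eval_signal_def)

lemma eval_signal_add:
  "eval_signal J x N a (p + q) = eval_signal J x N a p + eval_signal J x N a q"
  by (simp add: eval_signal_def higher_pderiv_add ring_distribs sum.distrib)

lemma eval_signal_smult: "eval_signal J x N a (Polynomial.smult c p) = c * eval_signal J x N a p"
  by (simp add: eval_signal_def higher_pderiv_smult sum_distrib_left mult_ac)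

lemma eval_signal_sum: "eval_signal J x N a (\<Sum>i\<in>I. f i) = (\<Sum>i\<in>I. eval_signal J x N a (f i))"
  by (induction I rule: infinite_finite_induct) (simp_all add: eval_signal_add)

lemma degree_node_poly: "degree (node_poly J x N) = (\<Sum>j\<in>J. N j)"
  by (simp add: node_poly_def degree_prod_sum_eq degree_linear_power)

lemma monic_node_poly: "lead_coeff (node_poly J x N) = 1"
  unfolding node_poly_def lead_coeff_prod lead_coeff_power by simp

lemma node_poly_nonzero [simp]: "node_poly J x N \<noteq> 0"
  using monic_node_poly[of J x N] by auto

lemma poly_node_poly: "poly (node_poly J x N) z = (\<Prod>j\<in>J. (z - x j) ^ N j)"
  by (simp add: node_poly_def poly_prod)

lemma linear_power_dvd_node_poly:
  assumes "finite J" "j \<in> J"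
  shows "[:- x j, 1:] ^ N j dvd node_poly J x N"
  unfolding node_poly_def using assms by (rule dvd_prodI)

lemma poly_node_poly_Diff_nonzero:
  assumes "finite J" "inj_on x J" "j \<in> J"
  shows "poly (node_poly (J - {j}) x N) (x j) \<noteq> 0"
  using assms by (auto simp: poly_node_poly inj_on_def)

lemma eval_signal_multiple_of_node_poly:
  assumes "finite J" "node_poly J x N dvd p"
  shows "eval_signal J x N a p = 0"
  unfolding eval_signal_def
proof (intro sum.neutral ballI)
  fix j l assume j: "j \<in> J" and l: "l \<in> {..<N j}"
  have "[:- x j, 1:] ^ N j dvd p"
    using linear_power_dvd_node_poly[OF assms(1) j] assms(2) by (rule dvd_trans)
  thus "a j l * poly ((pderiv ^^ l) p) (x j) = 0"
    using poly_higher_pderiv_eq_0_of_dvd[of "x j" "N j" p l] l by simp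
qed

text \<open>At every other node the factor \<open>node_poly (J - {j}) x N\<close> vanishes to full order. At \<open>x j\<close> the
  factor \<open>(X - x j) ^ n\<close> kills all derivatives of order below \<open>n\<close>, and those of order above \<open>n\<close> have
  coefficient zero, so that only the derivative of order \<open>n\<close> contributes.\<close>

lemma eval_signal_extract_coeff:
  assumes fin: "finite J" and j: "j \<in> J" and n: "n < N j"
    and top: "\<And>l. n < l \<Longrightarrow> l < N j \<Longrightarrow> a j l = 0"
  shows "eval_signal J x N a ([:- x j, 1:] ^ n * (node_poly (J - {j}) x N * g)) =
    a j n * fact n * poly (node_poly (J - {j}) x N) (x j) * poly g (x j)"
proof -
  define p where "p = [:- x j, 1:] ^ n * (node_poly (J - {j}) x N * g)"
  have other: "poly ((pderiv ^^ l) p) (x i) = 0" if "i \<in> J - {j}" "l < N i" for i l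
  proof (rule poly_higher_pderiv_eq_0_of_dvd[OF _ that(2)])
    show "[:- x i, 1:] ^ N i dvd p"
      unfolding p_def using linear_power_dvd_node_poly[of "J - {j}" i x N] fin that(1) by auto
  qed
  have here: "a j l * poly ((pderiv ^^ l) p) (x j) =
      (if l = n then a j n * fact n * poly (node_poly (J - {j}) x N * g) (x j) else 0)"
    if "l < N j" for l
    using poly_higher_pderiv_linear_power_mult[of l n "x j" "node_poly (J - {j}) x N * g"] top[of l] that
    by (cases "l \<le> n") (auto simp: p_def)
  have "eval_signal J x N a p = (\<Sum>i\<in>{j}. \<Sum>l<N i. a i l * poly ((pderiv ^^ l) p) (x i))"
    unfolding eval_signal_def
    by (rule sum.mono_neutral_right) (use fin j other in auto)
  also have "\<dots> = (\<Sum>l<N j. if l = n then a j n * fact n * poly (node_poly (J - {j}) x N * g) (x j) else 0)"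
    by (simp add: here)
  also have "\<dots> = a j n * fact n * poly (node_poly (J - {j}) x N) (x j) * poly g (x j)"
    using n by simp
  finally show ?thesis by (simp add: p_def)
qed

lemma degree_node_poly_Diff:
  assumes "finite J" "j \<in> J"
  shows "degree (node_poly (J - {j}) x N) + N j = (\<Sum>i\<in>J. N i)"
  using assms by (simp add: degree_node_poly sum.remove)

text \<open>This is the injectivity of the confluent Vandermonde system. If some coefficient at node \<open>j\<close> is
  non-zero, the test polynomial for the highest such coefficient has degree below
  \<open>\<Sum>j\<in>J. N j\<close> and extracts it.\<close>

lemma signal_coeffs_eq_0:
  assumes fin: "finite J" and inj: "inj_on x J"
    and zero: "\<And>k. k < (\<Sum>j\<in>J. N j) \<Longrightarrow> eval_signal J x N a (monom 1 k) = 0"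
    and j: "j \<in> J" and l: "l < N j"
  shows "a j l = 0"
proof (rule ccontr)
  assume "a j l \<noteq> 0"
  \<comment> \<open>the highest derivative that occurs at node \<open>j\<close>\<close>
  define n where "n = Max {i. i < N j \<and> a j i \<noteq> 0}"
  have "n \<in> {i. i < N j \<and> a j i \<noteq> 0}"
    unfolding n_def by (rule Max_in) (use l \<open>a j l \<noteq> 0\<close> in auto)
  hence n: "n < N j" "a j n \<noteq> 0" by auto
  have top: "a j i = 0" if "n < i" "i < N j" for i
  proof (rule ccontr)
    assume "a j i \<noteq> 0"
    hence "i \<le> n" unfolding n_def using that by (intro Max_ge) auto
    thus False using that by simp
  qed
  define p where "p = [:- x j, 1:] ^ n * (node_poly (J - {j}) x N * 1)"
  have "degree p < (\<Sum>i\<in>J. N i)"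
    using degree_node_poly_Diff[OF fin j, of x N] n(1)
    by (simp add: p_def degree_mult_eq degree_linear_power)
  hence p: "p = (\<Sum>k<(\<Sum>i\<in>J. N i). Polynomial.smult (coeff p k) (monom 1 k))"
    by (intro poly_eq_sum_monom) (auto simp: coeff_eq_0)
  have "eval_signal J x N a p = 0"
    by (subst p) (simp add: eval_signal_sum eval_signal_smult zero del: smult_monom)
  moreover have "eval_signal J x N a p \<noteq> 0"
    unfolding p_def using n(2) poly_node_poly_Diff_nonzero[OF fin inj j, of N]
    by (subst eval_signal_extract_coeff[where N = N and j = j and n = n, OF fin j n(1)]) (auto simp: top)
  ultimately show False by contradiction
qed

lemma node_poly_dvd:
  assumes "finite J" "inj_on x J" "v \<noteq> 0" "\<And>j. j \<in> J \<Longrightarrow> N j \<le> Polynomial.order (x j) v"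
  shows "node_poly J x N dvd v"
  using assms
proof (induction J rule: finite_induct)
  case empty
  thus ?case by (simp add: node_poly_def)
next
  case (insert j J)
  then obtain w where w: "v = node_poly J x N * w" by (auto elim: dvdE)
  have "poly (node_poly J x N) (x j) \<noteq> 0"
    using poly_node_poly_Diff_nonzero[of "insert j J" x j N] insert by auto
  hence "Polynomial.order (x j) v = Polynomial.order (x j) w"
    using insert.prems(2) by (simp add: w order_mult order_0I)
  hence "[:- x j, 1:] ^ N j dvd w"
    using insert.prems(3)[of j] by (simp add: order_divides)
  hence "[:- x j, 1:] ^ N j * node_poly J x N dvd w * node_poly J x N"
    by (rule mult_dvd_mono) simp
  thus ?case
    using insert.hyps by (simp add: node_poly_def w mult.commute)
qed

text \<open>Since \<open>v\<close> is too small to be divisible by the node polynomial, it vanishes at some node \<open>x j\<close> only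
  to an order below \<open>N j\<close>. Multiplying \<open>v\<close> by the missing linear factors raises this order to
  \<open>N j - 1\<close> and kills all other nodes, so that the product extracts the leading coefficient at
  \<open>x j\<close>, which is not zero.\<close>

lemma eval_signal_nondegenerate:
  assumes fin: "finite J" and inj: "inj_on x J" and N: "\<And>j. j \<in> J \<Longrightarrow> 0 < N j"
    and a: "\<And>j. j \<in> J \<Longrightarrow> a j (N j - 1) \<noteq> 0"
    and v: "v \<noteq> 0" "degree v < (\<Sum>j\<in>J. N j)"
  shows "\<exists>i<(\<Sum>j\<in>J. N j). eval_signal J x N a (monom 1 i * v) \<noteq> 0"
proof (rule ccontr)
  let ?R = "\<Sum>j\<in>J. N j"
  assume "\<not> ?thesis"
  hence zero: "eval_signal J x N a (monom 1 i * v) = 0" if "i < ?R" for i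
    using that by auto
  have "\<not> node_poly J x N dvd v"
    using v dvd_imp_degree_le[of "node_poly J x N" v] by (auto simp: degree_node_poly)
  then obtain j where j: "j \<in> J" and ord: "Polynomial.order (x j) v < N j"
    using node_poly_dvd[OF fin inj v(1)] by (meson linorder_not_le)
  define e where "e = Polynomial.order (x j) v"
  obtain g where g: "v = [:- x j, 1:] ^ e * g" and "\<not> [:- x j, 1:] dvd g"
    using order_decomp[OF v(1)] unfolding e_def by blast
  hence g0: "poly g (x j) \<noteq> 0" by (simp add: poly_eq_0_iff_dvd)
  define p where "p = [:- x j, 1:] ^ (N j - 1 - e) * node_poly (J - {j}) x N"
  have "degree p < ?R"
    using degree_node_poly_Diff[OF fin j, of x N] N[OF j]
    by (simp add: p_def degree_mult_eq degree_linear_power)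
  hence p: "p = (\<Sum>k<?R. Polynomial.smult (coeff p k) (monom 1 k))"
    by (intro poly_eq_sum_monom) (auto simp: coeff_eq_0)
  have "eval_signal J x N a (p * v) = 0"
    by (subst p) (simp add: eval_signal_sum eval_signal_smult zero sum_distrib_right del: smult_monom)
  moreover have "p * v = [:- x j, 1:] ^ (N j - 1) * (node_poly (J - {j}) x N * g)"
  proof -
    have "[:- x j, 1:] ^ (N j - 1) = [:- x j, 1:] ^ (N j - 1 - e) * [:- x j, 1:] ^ e"
      using ord by (simp add: e_def flip: power_add)
    thus ?thesis by (simp only: p_def g mult_ac)
  qed
  moreover have "eval_signal J x N a ([:- x j, 1:] ^ (N j - 1) * (node_poly (J - {j}) x N * g)) \<noteq> 0"
    using a[OF j] g0 poly_node_poly_Diff_nonzero[OF fin inj j, of N] N[OF j]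
    by (subst eval_signal_extract_coeff[OF fin j]) auto
  ultimately show False by simp
qed

lemma moment_eq_eval_signal:
  assumes mon: "\<And>k. k < n \<Longrightarrow> eval_signal J x N a (monom 1 k) = m k"
    and high: "\<And>k. k \<ge> n \<Longrightarrow> coeff p k = 0"
  shows "moment m p = eval_signal J x N a p"
proof -
  have "eval_signal J x N a p = (\<Sum>k<n. coeff p k * eval_signal J x N a (monom 1 k))"
    by (subst poly_eq_sum_monom[OF high]) (simp_all only: eval_signal_sum eval_signal_smult)
  also have "\<dots> = (\<Sum>k<n. coeff p k * m k)"
    using mon by (intro sum.cong) auto
  also have "\<dots> = moment m p"
    by (rule moment_eq_sum[OF high, symmetric])
  finally show ?thesis by simp
qed

lemma prony_solution_eval_signal:
  "prony_solution d m s D x a \<longleftrightarrow>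
     (\<forall>j<s. 0 < D j) \<and> (\<Sum>j<s. D j) \<le> d \<and> inj_on x {..<s} \<and> (\<forall>j<s. a j (D j - 1) \<noteq> 0) \<and>
     (\<forall>k<2 * d. eval_signal {..<s} x D a (monom 1 k) = m k)"
  by (simp add: prony_solution_def eval_signal_def deriv_monom_eq)

section \<open>Hankel matrices: kernel and rank\<close>

lemma det_hankel_eq_0_iff:
  "Determinant.det (hankel m r r) = 0 \<longleftrightarrow>
     (\<exists>v. v \<noteq> 0 \<and> degree v < r \<and> (\<forall>i<r. moment m (monom 1 i * v) = 0))"
proof -
  have carrier: "hankel m r r \<in> carrier_mat r r"
    by (simp add: hankel_def)
  have mult: "vec_index (hankel m r r *\<^sub>v vec r (coeff v)) i = moment m (monom 1 i * v)"
    if "i < r" "degree v < r" for i v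
  proof -
    have "moment m (monom 1 i * v) = (\<Sum>j<r. m (i + j) * coeff v j)"
      by (rule moment_monom_mult_eq_sum) (use that in \<open>auto simp: coeff_eq_0\<close>)
    thus ?thesis
      using that by (simp add: hankel_def scalar_prod_def atLeast0LessThan)
  qed
  show ?thesis unfolding det_0_iff_vec_prod_zero_field[OF carrier]
  proof safe
    fix w assume w: "w \<in> carrier_vec r" "w \<noteq> 0\<^sub>v r" "hankel m r r *\<^sub>v w = 0\<^sub>v r"
    define v where "v = (\<Sum>j<r. monom (vec_index w j) j)"
    have coeff_v: "coeff v k = (if k < r then vec_index w k else 0)" for k
      by (auto simp: v_def coeff_sum)
    have vec_v: "vec r (coeff v) = w"
      using w(1) by (intro eq_vecI) (auto simp: coeff_v)
    have "v \<noteq> 0"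
    proof
      assume "v = 0"
      hence "w = 0\<^sub>v r" using vec_v by (intro eq_vecI) auto
      thus False using w(2) by simp
    qed
    moreover have "degree v < r"
      using \<open>v \<noteq> 0\<close> coeff_v[of "degree v"] by (auto split: if_splits)
    moreover have "moment m (monom 1 i * v) = 0" if "i < r" for i
      using mult[OF that \<open>degree v < r\<close>] w(3) that by (simp add: vec_v)
    ultimately show "\<exists>v. v \<noteq> 0 \<and> degree v < r \<and> (\<forall>i<r. moment m (monom 1 i * v) = 0)"
      by blast
  next
    fix v :: "complex poly"
    assume v: "v \<noteq> 0" "degree v < r" "\<forall>i<r. moment m (monom 1 i * v) = 0"
    have "hankel m r r *\<^sub>v vec r (coeff v) = 0\<^sub>v r"
      by (rule eq_vecI) (use v mult[OF _ v(2)] in \<open>auto simp: hankel_def\<close>)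
    moreover have "vec r (coeff v) \<noteq> 0\<^sub>v r"
    proof
      assume "vec r (coeff v) = 0\<^sub>v r"
      hence "vec_index (vec r (coeff v)) (degree v) = vec_index (0\<^sub>v r) (degree v)" by simp
      thus False using v by simp
    qed
    ultimately show "\<exists>w. w \<in> carrier_vec r \<and> w \<noteq> 0\<^sub>v r \<and> hankel m r r *\<^sub>v w = 0\<^sub>v r"
      by (intro exI[of _ "vec r (coeff v)"]) auto
  qed
qed

lemma hankel_kernel_trivial:
  assumes "Determinant.det (hankel m r r) \<noteq> 0"
    and "\<And>i. i < r \<Longrightarrow> (\<Sum>j<r. w j * m (i + j)) = 0" and "j < r"
  shows "w j = 0"
proof (rule ccontr)
  assume "w j \<noteq> 0"
  define v where "v = (\<Sum>j<r. monom (w j) j)"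
  have coeff_v: "coeff v k = (if k < r then w k else 0)" for k
    by (auto simp: v_def coeff_sum)
  have "v \<noteq> 0" using coeff_v[of j] \<open>w j \<noteq> 0\<close> \<open>j < r\<close> by auto
  moreover have "degree v < r"
    using \<open>v \<noteq> 0\<close> coeff_v[of "degree v"] by (auto split: if_splits)
  moreover have "moment m (monom 1 i * v) = 0" if "i < r" for i
    using assms(2)[OF that] by (subst moment_monom_mult_eq_sum[of r]) (auto simp: coeff_v mult.commute)
  ultimately show False
    using assms(1) by (auto simp: det_hankel_eq_0_iff)
qed

lemma rank_le_dim_row:
  fixes A :: "'a :: field mat"
  assumes "A \<in> carrier_mat n nc"
  shows "vec_space.rank n A \<le> n"
proof -
  interpret vec_space "TYPE('a)" n .
  have "lin_indpt {}"
    by (rule finite_lin_indpt2) auto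
  then obtain S where S: "maximal S (\<lambda>T. T \<subseteq> set (cols A) \<and> lin_indpt T)"
    using maximal_exists_superset[of "set (cols A)" "\<lambda>T. T \<subseteq> set (cols A) \<and> lin_indpt T" "{}"]
    by auto
  hence "S \<subseteq> carrier_vec n" "lin_indpt S"
    using cols_dim[of A] assms unfolding maximal_def by auto
  hence "card S \<le> n"
    using li_le_dim(2)[OF fin_dim] dim_is_n by auto
  thus ?thesis
    using rank_card_indpt[OF assms S] by simp
qed

text \<open>A non-singular \<open>M\<^sub>r\<close> makes the first \<open>r\<close> columns distinct and linearly independent, so the rank
  is \<open>r\<close> exactly when they span the column space.\<close>

lemma rank_hankel_eq_iff:
  assumes det: "Determinant.det (hankel m r r) \<noteq> 0" and "r \<le> d"
  shows "vec_space.rank d (hankel m d (d + 1)) = r \<longleftrightarrow>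
    (\<forall>c\<le>d. \<exists>w. \<forall>i<d. m (i + c) = (\<Sum>j<r. w j * m (i + j)))"
proof -
  interpret vec_space "TYPE(complex)" d .
  define A where "A = hankel m d (d + 1)"
  define C where "C = (\<lambda>c. vec d (\<lambda>i. m (i + c)))"
  define U where "U = C ` {..<r}"
  have A: "A \<in> carrier_mat d (d + 1)"
    by (simp add: A_def hankel_def)
  have cols: "set (cols A) = C ` {..d}"
  proof -
    have "col A c = C c" if "c \<le> d" for c
      using that by (intro eq_vecI) (auto simp: A_def hankel_def C_def)
    moreover have "set (cols A) = col A ` {0..<d + 1}"
      using A by (simp only: cols_def set_map set_upt carrier_matD)
    moreover have "{0..<d + 1} = {..d}"
      by auto
    ultimately show ?thesis
      by (metis (no_types, lifting) atMost_iff image_cong)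
  qed
  have inj: "inj_on C {..<r}"
  proof (rule inj_onI, rule ccontr)
    fix j k assume jk: "j \<in> {..<r}" "k \<in> {..<r}" "C j = C k" "j \<noteq> k"
    \<comment> \<open>If columns \<open>j\<close> and \<open>k\<close> coincide, the difference of two unit vectors is in the kernel.\<close>
    define w :: "nat \<Rightarrow> complex" where "w = (\<lambda>i. if i = j then 1 else if i = k then -1 else 0)"
    have "(\<Sum>l<r. w l * m (i + l)) = 0" if "i < r" for i
    proof -
      have "(\<Sum>l<r. w l * m (i + l)) = (\<Sum>l\<in>{j, k}. w l * m (i + l))"
        by (rule sum.mono_neutral_right) (use jk in \<open>auto simp: w_def\<close>)
      also have "\<dots> = m (i + j) - m (i + k)"
        using jk by (simp add: w_def)
      also have "\<dots> = vec_index (C j) i - vec_index (C k) i"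
        using that \<open>r \<le> d\<close> by (simp add: C_def)
      finally show ?thesis using jk by simp
    qed
    hence "w j = 0" using jk(1) by (auto intro: hankel_kernel_trivial[OF det, of w j])
    thus False by (simp add: w_def)
  qed
  have U: "finite U" "U \<subseteq> carrier_vec d" "card U = r" "U \<subseteq> set (cols A)"
    using inj \<open>r \<le> d\<close> by (auto simp: U_def C_def cols card_image)
  have lincomb_U: "vec_index (lincomb f U) i = (\<Sum>j<r. f (C j) * m (i + j))" if "i < d" for f i
  proof -
    have "vec_index (lincomb f U) i = (\<Sum>u\<in>U. f u * vec_index u i)"
      by (rule lincomb_index[OF that U(2)])
    also have "\<dots> = (\<Sum>j<r. f (C j) * vec_index (C j) i)"
      by (simp add: U_def sum.reindex[OF inj])
    also have "\<dots> = (\<Sum>j<r. f (C j) * m (i + j))"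
      using that by (intro sum.cong refl) (simp add: C_def)
    finally show ?thesis .
  qed
  have indpt: "lin_indpt U"
  proof (rule finite_lin_indpt2)
    show "finite U" by fact
    show "U \<subseteq> carrier_vec d" by fact
  next
    fix f assume f: "lincomb f U = 0\<^sub>v d"
    have "f (C j) = 0" if "j < r" for j
    proof (rule hankel_kernel_trivial[OF det _ that])
      fix i assume "i < r"
      thus "(\<Sum>j<r. f (C j) * m (i + j)) = 0"
        using lincomb_U[of i f] \<open>r \<le> d\<close> by (simp add: f)
    qed
    thus "\<forall>v\<in>U. f v = 0" by (auto simp: U_def)
  qed
  have span: "C c \<in> span U \<longleftrightarrow> (\<exists>w. \<forall>i<d. m (i + c) = (\<Sum>j<r. w j * m (i + j)))" for c
  proof
    assume "C c \<in> span U"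
    then obtain f where f: "lincomb f U = C c"
      using finite_in_span[OF U(1,2)] by blast
    have "m (i + c) = (\<Sum>j<r. f (C j) * m (i + j))" if "i < d" for i
      using lincomb_U[OF that, of f] that by (simp add: f, simp add: C_def)
    thus "\<exists>w. \<forall>i<d. m (i + c) = (\<Sum>j<r. w j * m (i + j))"
      by (intro exI[of _ "\<lambda>j. f (C j)"]) auto
  next
    assume "\<exists>w. \<forall>i<d. m (i + c) = (\<Sum>j<r. w j * m (i + j))"
    then obtain w where w: "\<forall>i<d. m (i + c) = (\<Sum>j<r. w j * m (i + j))" by blast
    define f where "f = w \<circ> inv_into {..<r} C"
    have dim: "dim_vec (lincomb f U) = d"
      using lincomb_dim[OF U(1,2)] by simp
    have "lincomb f U = C c"
    proof (rule eq_vecI)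
      fix i assume "i < dim_vec (C c)"
      hence i: "i < d" by (simp add: C_def)
      show "vec_index (lincomb f U) i = vec_index (C c) i"
        using i w inj by (simp add: lincomb_U f_def, simp add: C_def)
    qed (simp add: dim C_def)
    thus "C c \<in> span U"
      unfolding finite_span[OF U(1,2)] by (auto intro!: exI[of _ f])
  qed
  have "rank A = r \<longleftrightarrow> (\<forall>c\<le>d. C c \<in> span U)"
  proof
    assume rank: "rank A = r"
    show "\<forall>c\<le>d. C c \<in> span U"
    proof (intro allI impI, rule ccontr)
      fix c assume c: "c \<le> d" "C c \<notin> span U"
      hence "C c \<notin> U" using in_own_span[OF U(2)] by auto
      moreover have "C c \<in> carrier_vec d" by (simp add: C_def)
      ultimately have "lin_indpt (U \<union> {C c})"
        using lin_dep_iff_in_span[of U "C c"] U(2) indpt c(2) by simp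
      hence "card (U \<union> {C c}) \<le> rank A"
        by (intro rank_ge_card_indpt[OF A]) (use U c in \<open>auto simp: cols\<close>)
      thus False using \<open>C c \<notin> U\<close> U rank by simp
    qed
  next
    assume all: "\<forall>c\<le>d. C c \<in> span U"
    have "maximal U (\<lambda>T. T \<subseteq> set (cols A) \<and> lin_indpt T)"
      unfolding maximal_def
    proof (intro conjI allI impI U(4) indpt)
      fix T assume T: "U \<subseteq> T \<and> T \<subseteq> set (cols A) \<and> lin_indpt T"
      show "T = U"
      proof (rule ccontr)
        assume "T \<noteq> U"
        then obtain t where t: "t \<in> T" "t \<notin> U" using T by auto
        hence "t \<in> carrier_vec d" "t \<in> span U"
          using T all by (auto simp: cols C_def)
        hence "lin_dep (U \<union> {t})"
          using lin_dep_iff_in_span[OF U(2) indpt _ t(2)] by blast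
        moreover have "lin_indpt (U \<union> {t})"
          by (rule subset_li_is_li[of T]) (use T t in auto)
        ultimately show False by contradiction
      qed
    qed
    thus "rank A = r" using rank_card_indpt[OF A] U(3) by simp
  qed
  thus ?thesis by (simp add: span A_def)
qed

section \<open>Solvability of the Prony problem\<close>

text \<open>The polynomial form of the previous spanning property: modulo polynomials that are orthogonal to
  \<open>X ^ i\<close> for all \<open>i < d\<close>, everything of degree at most \<open>d\<close> reduces to degree below \<open>r\<close>.\<close>

lemma hankel_column_reduction:
  assumes det: "Determinant.det (hankel m r r) \<noteq> 0" and "r \<le> d"
    and rank: "vec_space.rank d (hankel m d (d + 1)) = r" and "degree p \<le> d"
  shows "\<exists>W. (\<forall>k\<ge>r. coeff W k = 0) \<and> (\<forall>i<d. moment m (monom 1 i * W) = moment m (monom 1 i * p))"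
proof -
  obtain w where w: "\<And>c i. c \<le> d \<Longrightarrow> i < d \<Longrightarrow> m (i + c) = (\<Sum>j<r. w c j * m (i + j))"
    using rank_hankel_eq_iff[OF det \<open>r \<le> d\<close>] rank by metis
  define W where "W = (\<Sum>c<Suc d. Polynomial.smult (coeff p c) (\<Sum>j<r. monom (w c j) j))"
  have "coeff W k = 0" if "k \<ge> r" for k
    using that by (simp add: W_def coeff_sum del: sum.lessThan_Suc)
  moreover have "moment m (monom 1 i * W) = moment m (monom 1 i * p)" if "i < d" for i
  proof -
    have "moment m (monom 1 i * W) = (\<Sum>c<Suc d. coeff p c * (\<Sum>j<r. w c j * m (i + j)))"
      by (simp add: W_def sum_distrib_left moment_sum moment_smult mult_monom del: sum.lessThan_Suc)
    also have "\<dots> = (\<Sum>c<Suc d. m (i + c) * coeff p c)"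
      by (rule sum.cong) (use w that in \<open>auto simp: less_Suc_eq_le\<close>)
    also have "\<dots> = moment m (monom 1 i * p)"
      by (rule moment_monom_mult_eq_sum[symmetric]) (use \<open>degree p \<le> d\<close> in \<open>auto simp: coeff_eq_0\<close>)
    finally show ?thesis .
  qed
  ultimately show ?thesis by blast
qed

text \<open>The polynomial \<open>q\<close> comes from reducing \<open>X ^ r\<close>, which covers \<open>i < d\<close>. Larger indices
  \<open>t < 2 * d - r\<close> are treated in increasing order. With \<open>e = t - (d - 1)\<close>, the polynomial \<open>X ^ e * q\<close>
  has degree at most \<open>d\<close>, so it reduces to some \<open>V\<close> of degree below \<open>r\<close>. The moments of smaller
  index vanish, so \<open>V\<close> is in the kernel of \<open>M\<^sub>r\<close> and hence zero, and row \<open>d - 1\<close> of this reduction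
  says that the moment of \<open>X ^ t * q\<close> is zero.\<close>

lemma hankel_recurrence_exists:
  assumes det: "Determinant.det (hankel m r r) \<noteq> 0" and "r \<le> d"
    and rank: "vec_space.rank d (hankel m d (d + 1)) = r"
  obtains q where "lead_coeff q = 1" "degree q = r"
    "\<And>i. i < 2 * d - r \<Longrightarrow> moment m (monom 1 i * q) = 0"
proof -
  obtain W where W: "\<forall>k\<ge>r. coeff W k = 0"
      "\<forall>i<d. moment m (monom 1 i * W) = moment m (monom 1 i * monom 1 r)"
    using hankel_column_reduction[OF det \<open>r \<le> d\<close> rank, of "monom 1 r"] \<open>r \<le> d\<close>
    by (auto simp: degree_monom_eq)
  define q where "q = monom 1 r - W"
  have "degree q \<le> r"
    by (rule degree_le) (use W(1) in \<open>auto simp: q_def\<close>)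
  moreover have "coeff q r = 1"
    using W(1) by (simp add: q_def)
  ultimately have q: "degree q = r" "lead_coeff q = 1"
    using le_degree[of q r] by auto
  have low: "moment m (monom 1 i * q) = 0" if "i < d" for i
    using W(2) that by (simp add: q_def right_diff_distrib moment_diff)
  have "moment m (monom 1 t * q) = 0" if "t < 2 * d - r" for t
    using that
  proof (induction t rule: less_induct)
    case (less t)
    show ?case
    proof (cases "t < d")
      case True
      thus ?thesis by (rule low)
    next
      case False
      define e where "e = t - (d - 1)"
      have e: "t = d - 1 + e" "e + r \<le> d" "0 < d" "r < d"
        using False less.prems by (auto simp: e_def)
      have shift: "monom 1 i * (monom 1 e * q) = monom 1 (i + e) * q" for i
        by (simp add: mult_monom flip: mult.assoc)
      have "degree (monom 1 e * q) \<le> d"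
        using q e(2) degree_mult_le[of "monom 1 e" q] by (simp add: degree_monom_eq)
      then obtain V where V: "\<forall>k\<ge>r. coeff V k = 0"
          "\<And>i. i < d \<Longrightarrow> moment m (monom 1 i * V) = moment m (monom 1 (i + e) * q)"
        using hankel_column_reduction[OF det \<open>r \<le> d\<close> rank, of "monom 1 e * q"] by (auto simp: shift)
      have "moment m (monom 1 i * V) = 0" if "i < r" for i
        using V(2)[of i] less.IH[of "i + e"] less.prems that e by simp
      hence "V = 0"
        using det V(1) degree_less_iff_coeff[of V r] by (auto simp: det_hankel_eq_0_iff)
      thus ?thesis using V(2)[of "d - 1"] e by simp
    qed
  qed
  thus ?thesis using that q by blast
qed

text \<open>The confluent Vandermonde matrix is square, so injectivity implies surjectivity. Its columns are
  numbered by a bijection \<open>h\<close> with the set of pairs \<open>(j, l)\<close>.\<close>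

lemma confluent_interpolation:
  assumes fin: "finite J" and inj: "inj_on x J"
  shows "\<exists>a. \<forall>k<(\<Sum>j\<in>J. N j). eval_signal J x N a (monom 1 k) = m k"
proof -
  define R where "R = (\<Sum>j\<in>J. N j)"
  define I where "I = Sigma J (\<lambda>j. {..<N j})"
  have "card I = R" "finite I"
    using fin by (simp_all add: I_def R_def)
  then obtain h where h: "bij_betw h {0..<R} I"
    using ex_bij_betw_nat_finite[of I] by auto
  define h' where "h' = inv_into {0..<R} h"
  define A where "A = mat R R (\<lambda>(k, t). poly ((pderiv ^^ snd (h t)) (monom 1 k)) (x (fst (h t))))"
  define coeffs :: "complex Matrix.vec \<Rightarrow> 'a \<Rightarrow> nat \<Rightarrow> complex"
    where "coeffs = (\<lambda>v j l. vec_index v (h' (j, l)))"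
  have A: "A \<in> carrier_mat R R" by (simp add: A_def)
  have mult: "eval_signal J x N (coeffs v) (monom 1 k) = vec_index (A *\<^sub>v v) k"
    if "k < R" "v \<in> carrier_vec R" for k v
  proof -
    have "eval_signal J x N (coeffs v) (monom 1 k) =
        (\<Sum>(j, l)\<in>I. coeffs v j l * poly ((pderiv ^^ l) (monom 1 k)) (x j))"
      unfolding eval_signal_def I_def using fin by (simp add: sum.Sigma)
    also have "\<dots> = (\<Sum>t\<in>{0..<R}. (\<lambda>(j, l). coeffs v j l * poly ((pderiv ^^ l) (monom 1 k)) (x j)) (h t))"
      using h by (rule sum.reindex_bij_betw[symmetric])
    also have "\<dots> = (\<Sum>t\<in>{0..<R}. poly ((pderiv ^^ snd (h t)) (monom 1 k)) (x (fst (h t))) * vec_index v t)"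
    proof (rule sum.cong)
      fix t assume "t \<in> {0..<R}"
      hence "h' (h t) = t"
        using h by (auto simp: h'_def bij_betw_def)
      thus "(\<lambda>(j, l). coeffs v j l * poly ((pderiv ^^ l) (monom 1 k)) (x j)) (h t) =
          poly ((pderiv ^^ snd (h t)) (monom 1 k)) (x (fst (h t))) * vec_index v t"
        by (simp add: case_prod_unfold coeffs_def)
    qed simp
    also have "\<dots> = vec_index (A *\<^sub>v v) k"
      using that by (simp add: A_def scalar_prod_def)
    finally show ?thesis .
  qed
  have "Determinant.det A \<noteq> 0"
  proof
    assume "Determinant.det A = 0"
    then obtain v where v: "v \<in> carrier_vec R" "v \<noteq> 0\<^sub>v R" "A *\<^sub>v v = 0\<^sub>v R"
      using det_0_iff_vec_prod_zero_field[OF A] by blast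
    have "eval_signal J x N (coeffs v) (monom 1 k) = 0" if "k < (\<Sum>j\<in>J. N j)" for k
      using mult[of k v] that v(1) by (simp add: v(3) R_def)
    note zero = signal_coeffs_eq_0[of J x N "coeffs v", OF fin inj this]
    have "vec_index v t = 0" if "t < R" for t
    proof -
      have "h t \<in> I" "h' (h t) = t"
        using h that by (auto simp: h'_def bij_betw_def)
      thus ?thesis
        using zero[of "fst (h t)" "snd (h t)"] by (auto simp: coeffs_def I_def)
    qed
    hence "v = 0\<^sub>v R" using v(1) by (intro eq_vecI) auto
    thus False using v(2) by contradiction
  qed
  from det_non_zero_imp_unit[OF A this, of "()"]
  obtain B where B: "B \<in> carrier_mat R R" "A * B = 1\<^sub>m R"
    by (auto simp: Units_def ring_mat_def)
  have "A *\<^sub>v (B *\<^sub>v vec R m) = vec R m"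
    using A B by (simp flip: assoc_mult_mat_vec[OF A B(1)])
  moreover have "B *\<^sub>v vec R m \<in> carrier_vec R"
    using B(1) by simp
  ultimately have "\<forall>k<R. eval_signal J x N (coeffs (B *\<^sub>v vec R m)) (monom 1 k) = m k"
    using mult by simp
  thus ?thesis unfolding R_def by blast
qed

text \<open>Nondegeneracy gives the determinant. For the rank, the remainder of \<open>X ^ c\<close> modulo the node
  polynomial has degree below \<open>R\<close> and, being congruent to \<open>X ^ c\<close>, the same column of moments.\<close>

lemma prony_solution_imp_det_rank:
  assumes sol: "prony_solution d m s D x a"
  defines "R \<equiv> \<Sum>j<s. D j"
  shows "Determinant.det (hankel m R R) \<noteq> 0" "vec_space.rank d (hankel m d (d + 1)) = R"
proof -
  have R: "R \<le> d" and inj: "inj_on x {..<s}" and pos: "\<And>j. j \<in> {..<s} \<Longrightarrow> 0 < D j"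
    and top: "\<And>j. j \<in> {..<s} \<Longrightarrow> a j (D j - 1) \<noteq> 0"
    using sol by (auto simp: prony_solution_def R_def)
  have moment: "moment m p = eval_signal {..<s} x D a p" if "p = 0 \<or> degree p < 2 * d" for p
    by (rule moment_eq_eval_signal[of "2 * d"])
      (use sol that in \<open>auto simp: prony_solution_eval_signal coeff_eq_0\<close>)
  show det: "Determinant.det (hankel m R R) \<noteq> 0"
  proof
    assume "Determinant.det (hankel m R R) = 0"
    then obtain v where v: "v \<noteq> 0" "degree v < R" "\<forall>i<R. moment m (monom 1 i * v) = 0"
      by (auto simp: det_hankel_eq_0_iff)
    obtain i where i: "i < R" "eval_signal {..<s} x D a (monom 1 i * v) \<noteq> 0"
      using eval_signal_nondegenerate[of "{..<s}" x D a v] inj pos top v(1,2) unfolding R_def by auto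
    have "degree (monom 1 i * v) < 2 * d"
      using v(1,2) i(1) R by (simp add: degree_mult_eq degree_monom_eq)
    thus False using moment[of "monom 1 i * v"] v(3) i by auto
  qed
  have "\<exists>w. \<forall>i<d. m (i + c) = (\<Sum>j<R. w j * m (i + j))" if "c \<le> d" for c
  proof -
    define Q where "Q = node_poly {..<s} x D"
    define v where "v = monom 1 c mod Q"
    have "degree Q = R" by (simp add: Q_def R_def degree_node_poly)
    hence v: "\<forall>k\<ge>R. coeff v k = 0"
      using degree_mod_less[of Q "monom 1 c"] by (auto simp: v_def Q_def coeff_eq_0)
    have "m (i + c) = (\<Sum>j<R. coeff v j * m (i + j))" if "i < d" for i
    proof -
      define p where "p = monom 1 i * (monom 1 c - v)"
      have "degree v \<le> d"
        using v R \<open>c \<le> d\<close> by (cases "v = 0") (auto intro!: degree_le)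
      hence "degree (monom 1 c - v) \<le> d"
        using \<open>c \<le> d\<close> by (intro degree_diff_le) (auto simp: degree_monom_eq)
      hence "degree p < 2 * d"
        using \<open>i < d\<close> degree_mult_le[of "monom 1 i" "monom 1 c - v"]
        by (simp add: p_def degree_monom_eq)
      moreover have "Q dvd p"
        unfolding p_def v_def by (intro dvd_mult) (simp add: minus_mod_eq_mult_div)
      ultimately have "moment m p = 0"
        using eval_signal_multiple_of_node_poly[of "{..<s}" x D p a] by (simp add: moment Q_def)
      hence "m (i + c) = moment m (monom 1 i * v)"
        by (simp add: p_def right_diff_distrib moment_diff mult_monom)
      thus ?thesis
        using moment_monom_mult_eq_sum[of R v m i] v by (simp only: mult.commute)
    qed
    thus ?thesis by blast
  qed
  thus "vec_space.rank d (hankel m d (d + 1)) = R"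
    using rank_hankel_eq_iff[OF det R] by blast
qed

text \<open>The nodes are the roots of \<open>q\<close>, with their orders as multiplicities. The coefficients are chosen
  to match the first \<open>r\<close> moments.\<close>

lemma prony_solution_exists:
  assumes det: "Determinant.det (hankel m r r) \<noteq> 0"
    and rank: "vec_space.rank d (hankel m d (d + 1)) = r"
  shows "\<exists>s D x a. prony_solution d m s D x a"
proof -
  have "r \<le> d"
    using rank_le_dim_row[of "hankel m d (d + 1)" d "d + 1"] rank by (simp add: hankel_def)
  then obtain q where q: "lead_coeff q = 1" "degree q = r"
      "\<And>i. i < 2 * d - r \<Longrightarrow> moment m (monom 1 i * q) = 0"
    using hankel_recurrence_exists[OF det _ rank] by blast
  have "q \<noteq> 0" using q(1) by auto
  define s where "s = card {z. poly q z = 0}"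
  obtain x where "bij_betw x {0..<s} {z. poly q z = 0}"
    using ex_bij_betw_nat_finite[OF poly_roots_finite[OF \<open>q \<noteq> 0\<close>]] by (auto simp: s_def)
  hence x: "bij_betw x {..<s} {z. poly q z = 0}" by (simp add: atLeast0LessThan)
  hence inj: "inj_on x {..<s}" by (simp add: bij_betw_def)
  define D where "D = (\<lambda>j. Polynomial.order (x j) q)"
  have "q = (\<Prod>z | poly q z = 0. [:-z, 1:] ^ Polynomial.order z q)"
    using complex_poly_decompose[of q] q(1) by simp
  also have "\<dots> = node_poly {..<s} x D"
    unfolding node_poly_def D_def using x by (rule prod.reindex_bij_betw[symmetric])
  finally have q_eq: "q = node_poly {..<s} x D" .
  hence r: "(\<Sum>j<s. D j) = r"
    using q(2) by (simp add: degree_node_poly)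
  have pos: "0 < D j" if "j < s" for j
  proof -
    have "poly q (x j) = 0" using x that by (auto simp: bij_betw_def)
    thus ?thesis using \<open>q \<noteq> 0\<close> by (simp add: D_def order_root)
  qed
  obtain a where a: "\<And>k. k < r \<Longrightarrow> eval_signal {..<s} x D a (monom 1 k) = m k"
    using confluent_interpolation[OF _ inj, of D m] by (auto simp: r)
  have eval: "eval_signal {..<s} x D a (monom 1 k) = m k" if k: "k < 2 * d" for k
  proof -
    \<comment> \<open>Both functionals annihilate \<open>g * q\<close> and agree on the remainder \<open>v\<close>.\<close>
    define g v where "g = monom 1 k div q" and "v = monom 1 k mod q"
    have mon: "monom 1 k = g * q + v" by (simp add: g_def v_def)
    have v: "coeff v i = 0" if "i \<ge> r" for i
      using that degree_mod_less[OF \<open>q \<noteq> 0\<close>, of "monom 1 k"] q(2) by (auto simp: v_def coeff_eq_0)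
    have g: "coeff g i = 0" if "i \<ge> 2 * d - r" for i
    proof (cases "g = 0")
      case False
      have "degree v < 2 * d"
        using degree_mod_less[OF \<open>q \<noteq> 0\<close>, of "monom 1 k"] k q(2) \<open>r \<le> d\<close> by (auto simp: v_def)
      hence "degree (monom 1 k - v) < 2 * d"
        using k by (intro degree_diff_less) (auto simp: degree_monom_eq)
      moreover have "degree (monom 1 k - v) = degree g + r"
        using False \<open>q \<noteq> 0\<close> q(2) by (simp add: mon degree_mult_eq)
      ultimately show ?thesis using that by (intro coeff_eq_0) simp
    qed simp
    have "moment m (g * q) = 0"
      by (subst poly_eq_sum_monom[OF g])
        (auto simp: sum_distrib_right moment_sum moment_smult q(3) simp del: smult_monom intro!: sum.neutral)
    moreover have "moment m v = eval_signal {..<s} x D a v"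
      using a v by (rule moment_eq_eval_signal)
    moreover have "eval_signal {..<s} x D a (g * q) = 0"
      by (rule eval_signal_multiple_of_node_poly) (simp_all add: q_eq)
    ultimately show ?thesis
      using arg_cong[OF mon, of "moment m"] arg_cong[OF mon, of "eval_signal {..<s} x D a"]
      by (simp add: moment_add eval_signal_add)
  qed
  have top: "a j (D j - 1) \<noteq> 0" if j: "j < s" for j
  proof
    \<comment> \<open>Otherwise \<open>q / (X - x j)\<close> is a non-zero element of the kernel of \<open>M\<^sub>r\<close>.\<close>
    assume zero: "a j (D j - 1) = 0"
    define v where "v = [:- x j, 1:] ^ (D j - 1) * node_poly ({..<s} - {j}) x D"
    have "v \<noteq> 0" by (simp add: v_def)
    moreover have deg: "degree v < r"
      using degree_node_poly_Diff[of "{..<s}" j x D] j pos[OF j]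
      by (simp add: v_def degree_mult_eq degree_linear_power r)
    moreover have "moment m (monom 1 i * v) = 0" if "i < r" for i
    proof -
      have "degree (monom 1 i * v) < 2 * d"
        using \<open>v \<noteq> 0\<close> deg that \<open>r \<le> d\<close> by (simp add: degree_mult_eq degree_monom_eq)
      hence "moment m (monom 1 i * v) = eval_signal {..<s} x D a (monom 1 i * v)"
        using eval by (intro moment_eq_eval_signal[of "2 * d"]) (auto intro: coeff_eq_0)
      also have "eval_signal {..<s} x D a (monom 1 i * v) = eval_signal {..<s} x D a
          ([:- x j, 1:] ^ (D j - 1) * (node_poly ({..<s} - {j}) x D * monom 1 i))"
        by (simp only: v_def mult_ac)
      also have "\<dots> = 0"
        using eval_signal_extract_coeff[of "{..<s}" j "D j - 1" D a x "monom 1 i"] j pos[OF j] zero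
        by simp
      finally show ?thesis .
    qed
    ultimately show False using det by (auto simp: det_hankel_eq_0_iff)
  qed
  have "prony_solution d m s D x a"
    unfolding prony_solution_eval_signal
    using pos r \<open>r \<le> d\<close> inj top eval by simp
  thus ?thesis by blast
qed

section \<open>Uniqueness of the signal\<close>

text \<open>The coefficients of a signal as a function of the node and the order of the derivative. It is zero
  where the signal has no term, and it does not depend on the enumeration of the nodes. Two signals
  with different nodes can thus be subtracted.\<close>

definition node_coeff :: "nat \<Rightarrow> (nat \<Rightarrow> nat) \<Rightarrow> (nat \<Rightarrow> complex) \<Rightarrow> (nat \<Rightarrow> nat \<Rightarrow> complex) \<Rightarrow>
    complex \<Rightarrow> nat \<Rightarrow> complex" where
  "node_coeff s D x a y l = (\<Sum>j<s. if x j = y \<and> l < D j then a j l else 0)"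

definition node_mult :: "nat \<Rightarrow> (nat \<Rightarrow> nat) \<Rightarrow> (nat \<Rightarrow> complex) \<Rightarrow> complex \<Rightarrow> nat" where
  "node_mult s D x y = (\<Sum>j<s. if x j = y then D j else 0)"

lemma sum_at_node:
  fixes s :: nat
  assumes "inj_on x {..<s}" "j < s"
  shows "(\<Sum>i<s. if x i = x j \<and> b i then f i else 0) = (if b j then f j else 0)"
proof -
  have "(\<Sum>i<s. if x i = x j \<and> b i then f i else 0) = (\<Sum>i<s. if i = j then (if b j then f j else 0) else 0)"
    by (rule sum.cong) (use assms in \<open>auto simp: inj_on_def\<close>)
  thus ?thesis using assms(2) by simp
qed

lemma node_coeff_node:
  assumes "inj_on x {..<s}" "j < s"
  shows "node_coeff s D x a (x j) l = (if l < D j then a j l else 0)"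
  unfolding node_coeff_def by (rule sum_at_node[OF assms])

lemma node_mult_node:
  assumes "inj_on x {..<s}" "j < s"
  shows "node_mult s D x (x j) = D j"
  unfolding node_mult_def using sum_at_node[OF assms, of "\<lambda>_. True" D] by simp

lemma node_coeff_outside: "y \<notin> x ` {..<s} \<Longrightarrow> node_coeff s D x a y l = 0"
  unfolding node_coeff_def by (rule sum.neutral) auto

lemma sum_node_mult:
  assumes "finite S" "x ` {..<s} \<subseteq> S"
  shows "(\<Sum>y\<in>S. node_mult s D x y) = (\<Sum>j<s. D j)"
proof -
  have "(\<Sum>y\<in>S. node_mult s D x y) = (\<Sum>j<s. \<Sum>y\<in>S. if x j = y then D j else 0)"
    unfolding node_mult_def by (rule sum.swap)
  also have "\<dots> = (\<Sum>j<s. D j)"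
    by (rule sum.cong) (use assms in \<open>auto simp: image_subset_iff\<close>)
  finally show ?thesis .
qed

lemma eval_signal_node_coeff:
  assumes inj: "inj_on x {..<s}" and S: "finite S" "x ` {..<s} \<subseteq> S"
    and N: "\<And>j. j < s \<Longrightarrow> D j \<le> N (x j)"
  shows "eval_signal S id N (node_coeff s D x a) p = eval_signal {..<s} x D a p"
proof -
  have "eval_signal S id N (node_coeff s D x a) p =
      (\<Sum>y\<in>x ` {..<s}. \<Sum>l<N y. node_coeff s D x a y l * poly ((pderiv ^^ l) p) y)"
    unfolding eval_signal_def id_apply
    by (rule sum.mono_neutral_right) (use S in \<open>auto simp: node_coeff_outside\<close>)
  also have "\<dots> = (\<Sum>j<s. \<Sum>l<N (x j). node_coeff s D x a (x j) l * poly ((pderiv ^^ l) p) (x j))"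
    by (simp add: sum.reindex[OF inj])
  also have "\<dots> = eval_signal {..<s} x D a p"
    unfolding eval_signal_def
  proof (rule sum.cong)
    fix j assume "j \<in> {..<s}"
    hence j: "j < s" by simp
    have "(\<Sum>l<D j. a j l * poly ((pderiv ^^ l) p) (x j)) =
        (\<Sum>l<N (x j). node_coeff s D x a (x j) l * poly ((pderiv ^^ l) p) (x j))"
      by (rule sum.mono_neutral_cong_left) (use N[OF j] in \<open>auto simp: node_coeff_node[OF inj j]\<close>)
    thus "(\<Sum>l<N (x j). node_coeff s D x a (x j) l * poly ((pderiv ^^ l) p) (x j)) =
        (\<Sum>l<D j. a j l * poly ((pderiv ^^ l) p) (x j))" by simp
  qed simp
  finally show ?thesis .
qed

text \<open>The difference of the two solutions is a signal on the union of their nodes. With the sums of the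
  multiplicities as multiplicities its order is at most \<open>2 * d\<close>, and its moments of index below
  \<open>2 * d\<close> vanish.\<close>

lemma node_coeff_unique:
  assumes sol: "prony_solution d m s D x a" and sol': "prony_solution d m s' D' x' a'"
  shows "node_coeff s D x a y l = node_coeff s' D' x' a' y l"
proof -
  define S where "S = x ` {..<s} \<union> x' ` {..<s'}"
  define N where "N = (\<lambda>y. node_mult s D x y + node_mult s' D' x' y)"
  define b where "b = (\<lambda>y l. node_coeff s D x a y l - node_coeff s' D' x' a' y l)"
  have inj: "inj_on x {..<s}" "inj_on x' {..<s'}"
    using sol sol' by (auto simp: prony_solution_def)
  have S: "finite S" "x ` {..<s} \<subseteq> S" "x' ` {..<s'} \<subseteq> S"
    by (auto simp: S_def)
  have N: "j < s \<Longrightarrow> D j \<le> N (x j)" "j < s' \<Longrightarrow> D' j \<le> N (x' j)" for j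
    using inj by (simp_all add: N_def node_mult_node)
  have total: "(\<Sum>y\<in>S. N y) \<le> 2 * d"
    using sol sol' by (simp add: N_def sum.distrib sum_node_mult S prony_solution_def)
  have "eval_signal S id N b (monom 1 k) = 0" if "k < (\<Sum>y\<in>S. N y)" for k
  proof -
    have "eval_signal S id N b (monom 1 k) =
        eval_signal S id N (node_coeff s D x a) (monom 1 k) -
        eval_signal S id N (node_coeff s' D' x' a') (monom 1 k)"
      by (simp add: eval_signal_def b_def left_diff_distrib sum_subtractf)
    also have "\<dots> = eval_signal {..<s} x D a (monom 1 k) - eval_signal {..<s'} x' D' a' (monom 1 k)"
      using inj S N by (simp add: eval_signal_node_coeff)
    also have "\<dots> = 0"
      using sol sol' that total by (simp add: prony_solution_eval_signal)
    finally show ?thesis .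
  qed
  note inside = signal_coeffs_eq_0[of S id N b, OF S(1) inj_on_id this]
  have small: "node_coeff s D x a y l = 0" "node_coeff s' D' x' a' y l = 0"
    if "y \<notin> S \<or> l \<ge> N y"
  proof -
    show "node_coeff s D x a y l = 0"
    proof (cases "y \<in> x ` {..<s}")
      case True
      then obtain j where "j < s" "y = x j" by auto
      thus ?thesis using that N(1)[of j] S(2) by (auto simp: node_coeff_node[OF inj(1)])
    qed (rule node_coeff_outside)
    show "node_coeff s' D' x' a' y l = 0"
    proof (cases "y \<in> x' ` {..<s'}")
      case True
      then obtain j where "j < s'" "y = x' j" by auto
      thus ?thesis using that N(2)[of j] S(3) by (auto simp: node_coeff_node[OF inj(2)])
    qed (rule node_coeff_outside)
  qed
  show ?thesis
    using inside[of y l] small by (cases "y \<in> S \<and> l < N y") (auto simp: b_def)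
qed

text \<open>The leading coefficient at \<open>x j\<close> is non-zero, so it occurs in the second signal as well.\<close>

lemma matching_node:
  assumes sol: "prony_solution d m s D x a" and sol': "prony_solution d m s' D' x' a'" and j: "j < s"
  shows "\<exists>i<s'. x' i = x j \<and> D j \<le> D' i"
proof -
  have inj: "inj_on x {..<s}" "inj_on x' {..<s'}" and "0 < D j" "a j (D j - 1) \<noteq> 0"
    using sol sol' j by (auto simp: prony_solution_def)
  hence "node_coeff s D x a (x j) (D j - 1) \<noteq> 0"
    using j by (simp add: node_coeff_node)
  hence nz: "node_coeff s' D' x' a' (x j) (D j - 1) \<noteq> 0"
    using node_coeff_unique[OF sol sol'] by simp
  then obtain i where i: "i < s'" "x' i = x j"
    using node_coeff_outside[of "x j" x' s'] by fastforce
  have "D j - 1 < D' i"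
    using nz node_coeff_node[OF inj(2) i(1), of D' a' "D j - 1"] i(2) by (auto split: if_splits)
  thus ?thesis using i by auto
qed

lemma prony_solution_unique:
  assumes sol: "prony_solution d m s D x a" and sol': "prony_solution d m s' D' x' a'"
  shows "same_signal s D x a s' D' x' a'"
proof -
  have inj: "inj_on x {..<s}" "inj_on x' {..<s'}"
    using sol sol' by (auto simp: prony_solution_def)
  have nodes: "x ` {..<s} = x' ` {..<s'}"
  proof
    have "x j \<in> x' ` {..<s'}" if "j < s" for j
      using matching_node[OF sol sol' that] by (metis imageI lessThan_iff)
    thus "x ` {..<s} \<subseteq> x' ` {..<s'}" by auto
    have "x' j \<in> x ` {..<s}" if "j < s'" for j
      using matching_node[OF sol' sol that] by (metis imageI lessThan_iff)
    thus "x' ` {..<s'} \<subseteq> x ` {..<s}" by auto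
  qed
  hence "s' = s"
    using card_image[OF inj(1)] card_image[OF inj(2)] by simp
  define \<pi> where "\<pi> = (\<lambda>j. if j < s then inv_into {..<s} x' (x j) else j)"
  have \<pi>: "\<pi> j < s" "x' (\<pi> j) = x j" if "j < s" for j
  proof -
    have "x j \<in> x' ` {..<s}" using nodes that \<open>s' = s\<close> by auto
    thus "\<pi> j < s" "x' (\<pi> j) = x j"
      using that inv_into_into[of "x j" x' "{..<s}"] by (auto simp: \<pi>_def f_inv_into_f)
  qed
  have "inj_on \<pi> {..<s}"
    using inj(1) \<pi>(2) by (metis inj_on_def lessThan_iff)
  moreover have "\<pi> ` {..<s} \<subseteq> {..<s}"
    using \<pi>(1) by auto
  ultimately have "bij_betw \<pi> {..<s} {..<s}"
    by (simp add: bij_betw_def endo_inj_surj)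
  hence "\<pi> permutes {..<s}"
    by (rule bij_imp_permutes) (simp add: \<pi>_def)
  moreover have "D' (\<pi> j) = D j \<and> x' (\<pi> j) = x j \<and> (\<forall>l<D j. a' (\<pi> j) l = a j l)" if j: "j < s" for j
  proof -
    have mult: "D' (\<pi> j) = D j"
    proof (rule antisym)
      obtain i where i: "i < s'" "x' i = x j" "D j \<le> D' i"
        using matching_node[OF sol sol' j] by blast
      hence "i = \<pi> j"
        using inj(2) \<pi>[OF j] \<open>s' = s\<close> by (auto simp: inj_on_def)
      thus "D j \<le> D' (\<pi> j)" using i by simp
      obtain i' where i': "i' < s" "x i' = x' (\<pi> j)" "D' (\<pi> j) \<le> D i'"
        using matching_node[OF sol' sol, of "\<pi> j"] \<pi>(1)[OF j] \<open>s' = s\<close> by blast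
      hence "i' = j"
        using inj(1) \<pi>[OF j] j by (auto simp: inj_on_def)
      thus "D' (\<pi> j) \<le> D j" using i' by simp
    qed
    moreover have "a' (\<pi> j) l = a j l" if "l < D j" for l
      using node_coeff_unique[OF sol sol', of "x j" l] node_coeff_node[OF inj(1) j, of D a l]
        node_coeff_node[OF inj(2), of "\<pi> j" D' a' l] \<pi>[OF j] mult that \<open>s' = s\<close> by simp
    ultimately show ?thesis using \<pi>(2)[OF j] by blast
  qed
  ultimately show ?thesis
    unfolding same_signal_def using \<open>s' = s\<close> by blast
qed

section \<open>The diagonal Pade approximant and its poles\<close>

lemma deriv_monom_0: "deriv_monom k 0 y = y ^ k"
  by (simp add: deriv_monom_def)

text \<open>The Leibniz rule for the derivative of order \<open>l + 1\<close> of \<open>x * x ^ k\<close>.\<close>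

lemma deriv_monom_Suc_Suc:
  "deriv_monom (Suc k) (Suc l) y = y * deriv_monom k (Suc l) y + of_nat (Suc l) * deriv_monom k l y"
proof -
  consider "k < l" | "k = l" | n where "k = l + Suc n"
    by (metis less_imp_Suc_add linorder_neqE_nat add_Suc_right)
  thus ?thesis
  proof cases
    case 3
    define c where "c = (fact k / fact (Suc n) :: complex)"
    have "fact k / fact n = of_nat (Suc n) * c" "fact (Suc k) / fact (Suc n) = of_nat (Suc k) * c"
      by (simp_all add: c_def field_simps del: of_nat_Suc)
    hence "deriv_monom (Suc k) (Suc l) y = of_nat (Suc k) * c * y ^ Suc n"
        "deriv_monom k (Suc l) y = of_nat (Suc n) * c * y ^ n"
        "deriv_monom k l y = c * y ^ Suc n"
      unfolding deriv_monom_def c_def by (simp_all add: 3)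
    thus ?thesis
      by (simp add: 3 algebra_simps)
  qed (simp_all add: deriv_monom_def)
qed

text \<open>The error of the expansion
  \<open>l! / (z - y) ^ (l + 1) = \<Sum>k. deriv_monom k l y / z ^ (k + 1)\<close> at infinity, truncated after \<open>n\<close> terms.\<close>

definition inverse_tail :: "nat \<Rightarrow> nat \<Rightarrow> complex \<Rightarrow> complex \<Rightarrow> complex" where
  "inverse_tail n l y z = fact l / (z - y) ^ (l + 1) - (\<Sum>k<n. deriv_monom k l y / z ^ (k + 1))"

lemma inverse_tail_0:
  assumes "z \<noteq> 0" "z \<noteq> y"
  shows "inverse_tail n 0 y z = y ^ n / z ^ n * (1 / (z - y))"
proof -
  have "(z - y) * (\<Sum>k<n. deriv_monom k 0 y / z ^ (k + 1)) = 1 - y ^ n / z ^ n"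
  proof (induction n)
    case (Suc n)
    have "(z - y) * (y ^ n / z ^ (n + 1)) = y ^ n / z ^ n - y ^ Suc n / z ^ Suc n"
      using assms(1) by (simp add: field_simps)
    thus ?case
      using Suc.IH by (simp only: sum.lessThan_Suc distrib_left deriv_monom_0) simp
  qed simp
  hence "(\<Sum>k<n. deriv_monom k 0 y / z ^ (k + 1)) = (1 - y ^ n / z ^ n) / (z - y)"
    using assms(2) by (simp add: eq_divide_eq mult.commute)
  thus ?thesis
    by (simp add: inverse_tail_def diff_divide_distrib)
qed

text \<open>Multiplication by \<open>z - y\<close> turns the partial sum for \<open>l + 1\<close> into \<open>l + 1\<close> times the one for \<open>l\<close>, up to
  a boundary term, by the Leibniz rule for the derivatives of \<open>x * x ^ k\<close>.\<close>

lemma inverse_tail_Suc: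
  assumes "z \<noteq> 0" "z \<noteq> y"
  shows "inverse_tail n (Suc l) y z =
    (of_nat (Suc l) * inverse_tail n l y z + deriv_monom n (Suc l) y / z ^ n) * (1 / (z - y))"
proof -
  have "(z - y) * (\<Sum>k<n. deriv_monom k (Suc l) y / z ^ (k + 1)) =
      of_nat (Suc l) * (\<Sum>k<n. deriv_monom k l y / z ^ (k + 1)) - deriv_monom n (Suc l) y / z ^ n"
  proof (induction n)
    case 0
    show ?case by (simp add: deriv_monom_def)
  next
    case (Suc n)
    have "(z - y) * (deriv_monom n (Suc l) y / z ^ (n + 1)) =
        deriv_monom n (Suc l) y / z ^ n + of_nat (Suc l) * (deriv_monom n l y / z ^ (n + 1))
        - deriv_monom (Suc n) (Suc l) y / z ^ Suc n"
      using assms(1) by (simp add: deriv_monom_Suc_Suc field_simps del: of_nat_Suc)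
    thus ?case
      using Suc.IH by (simp only: sum.lessThan_Suc distrib_left) simp
  qed
  hence "(\<Sum>k<n. deriv_monom k (Suc l) y / z ^ (k + 1)) =
      (of_nat (Suc l) * (\<Sum>k<n. deriv_monom k l y / z ^ (k + 1)) - deriv_monom n (Suc l) y / z ^ n)
        * (1 / (z - y))"
    using assms(2) by (simp add: eq_divide_eq mult.commute del: of_nat_Suc)
  moreover have "fact (Suc l) / (z - y) ^ (Suc l + 1) =
      of_nat (Suc l) * (fact l / (z - y) ^ (l + 1)) * (1 / (z - y))"
    using assms(2) by (simp add: field_simps)
  ultimately show ?thesis
    unfolding inverse_tail_def by (simp only:) (simp only: ring_distribs diff_diff_eq2 diff_add_eq)
qed

lemma eventually_at_infinity_neq: "eventually (\<lambda>z::complex. z \<noteq> y) at_infinity"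
  unfolding eventually_at_infinity by (rule exI[of _ "norm y + 1"]) auto

lemma const_mult_bigo: "(\<lambda>z. c * f z) \<in> O[F](f)" for f :: "'a \<Rightarrow> complex"
  by (rule bigoI[of _ "norm c"]) (simp add: norm_mult)

lemma inverse_shift_bigo: "(\<lambda>z::complex. 1 / (z - y)) \<in> O[at_infinity](\<lambda>z. 1 / z)"
proof (rule bigoI[of _ 2])
  have "norm (1 / (z - y)) \<le> 2 * norm (1 / z)" if "norm z \<ge> 2 * norm y + 1" for z
  proof -
    have "norm z \<le> norm (z - y) + norm y"
      using norm_triangle_ineq[of "z - y" y] by simp
    hence "norm z \<le> 2 * norm (z - y)"
      using that by linarith
    moreover have "norm z > 0"
      using that norm_ge_zero[of y] by linarith
    moreover from calculation have "norm (z - y) > 0"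
      by linarith
    ultimately show ?thesis
      by (simp add: norm_divide field_simps)
  qed
  thus "\<forall>\<^sub>F z in at_infinity. norm (1 / (z - y)) \<le> 2 * norm (1 / z)"
    unfolding eventually_at_infinity by blast
qed

lemma inverse_power_bigo_mono:
  "n \<le> k \<Longrightarrow> (\<lambda>z::complex. 1 / z ^ k) \<in> O[at_infinity](\<lambda>z. 1 / z ^ n)"
proof (rule bigoI[of _ 1])
  assume "n \<le> k"
  have "norm (1 / z ^ k) \<le> 1 * norm (1 / z ^ n)" if "norm z \<ge> 1" for z :: complex
  proof -
    have "0 < norm z ^ n"
      using that by (intro zero_less_power) linarith
    thus ?thesis
      using power_increasing[OF \<open>n \<le> k\<close> that] by (simp add: norm_divide norm_power frac_le)
  qed
  thus "\<forall>\<^sub>F z in at_infinity. norm (1 / z ^ k) \<le> 1 * norm (1 / z ^ n :: complex)"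
    unfolding eventually_at_infinity by blast
qed

lemma inverse_tail_bigo: "inverse_tail n l y \<in> O[at_infinity](\<lambda>z. 1 / z ^ (n + 1))"
proof (induction l)
  case 0
  have "(\<lambda>z. y ^ n * (1 / z ^ n) * (1 / (z - y))) \<in> O[at_infinity](\<lambda>z. 1 / z ^ n * (1 / z))"
    by (intro landau_o.big.mult inverse_shift_bigo const_mult_bigo)
  also have "?this \<longleftrightarrow> ?case"
  proof (rule landau_o.big.cong_ex)
    show "\<forall>\<^sub>F z in at_infinity. y ^ n * (1 / z ^ n) * (1 / (z - y)) = inverse_tail n 0 y z"
      using eventually_at_infinity_neq[of 0] eventually_at_infinity_neq[of y]
      by eventually_elim (simp add: inverse_tail_0)
  qed (simp add: mult.commute)
  finally show ?case .
next
  case (Suc l)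
  have "(\<lambda>z. (of_nat (Suc l) * inverse_tail n l y z + deriv_monom n (Suc l) y * (1 / z ^ n)) * (1 / (z - y)))
      \<in> O[at_infinity](\<lambda>z. 1 / z ^ n * (1 / z))"
  proof (intro landau_o.big.mult inverse_shift_bigo sum_in_bigo const_mult_bigo)
    have "inverse_tail n l y \<in> O[at_infinity](\<lambda>z. 1 / z ^ n)"
      by (rule landau_o.big_trans[OF Suc.IH inverse_power_bigo_mono]) simp
    thus "(\<lambda>z. of_nat (Suc l) * inverse_tail n l y z) \<in> O[at_infinity](\<lambda>z. 1 / z ^ n)"
      by (rule landau_o.big_trans[OF const_mult_bigo])
  qed
  also have "?this \<longleftrightarrow> ?case"
  proof (rule landau_o.big.cong_ex)
    show "\<forall>\<^sub>F z in at_infinity. (of_nat (Suc l) * inverse_tail n l y z + deriv_monom n (Suc l) y * (1 / z ^ n)) * (1 / (z - y))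
        = inverse_tail n (Suc l) y z"
      using eventually_at_infinity_neq[of 0] eventually_at_infinity_neq[of y]
      by eventually_elim (simp add: inverse_tail_Suc)
  qed (simp add: mult.commute)
  finally show ?case .
qed

text \<open>The numerator of \<open>\<Sum>j l. a j l * l! / (z - x j) ^ (l + 1)\<close> over the common denominator
  \<open>node_poly J x N\<close>.\<close>

definition pade_numerator ::
  "'i set \<Rightarrow> ('i \<Rightarrow> complex) \<Rightarrow> ('i \<Rightarrow> nat) \<Rightarrow> ('i \<Rightarrow> nat \<Rightarrow> complex) \<Rightarrow> complex poly" where
  "pade_numerator J x N a = (\<Sum>j\<in>J. \<Sum>l<N j.
     Polynomial.smult (a j l * fact l) ([:- x j, 1:] ^ (N j - 1 - l) * node_poly (J - {j}) x N))"

lemma node_poly_split: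
  assumes "finite J" "j \<in> J"
  shows "node_poly J x N = [:- x j, 1:] ^ N j * node_poly (J - {j}) x N"
  unfolding node_poly_def using assms by (rule prod.remove)

lemma degree_pade_numerator:
  assumes "finite J"
  shows "pade_numerator J x N a = 0 \<or> degree (pade_numerator J x N a) < degree (node_poly J x N)"
proof -
  have "coeff (pade_numerator J x N a) k = 0" if "k \<ge> degree (node_poly J x N)" for k
    unfolding pade_numerator_def coeff_sum
  proof (intro sum.neutral ballI)
    fix j l assume j: "j \<in> J" and l: "l \<in> {..<N j}"
    have "degree ([:- x j, 1:] ^ (N j - 1 - l) * node_poly (J - {j}) x N) < degree (node_poly J x N)"
      using degree_node_poly_Diff[OF assms j, of x N] l
      by (simp add: degree_mult_eq degree_linear_power degree_node_poly[of J])
    thus "coeff (Polynomial.smult (a j l * fact l) ([:- x j, 1:] ^ (N j - 1 - l) * node_poly (J - {j}) x N)) k = 0"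
      using that by (simp add: coeff_eq_0)
  qed
  thus ?thesis by (simp add: degree_less_iff_coeff)
qed

lemma rat_fun_pade_numerator:
  assumes "finite J" and z: "z \<notin> x ` J"
  shows "rat_fun (pade_numerator J x N a) (node_poly J x N) z =
    (\<Sum>j\<in>J. \<Sum>l<N j. a j l * (fact l / (z - x j) ^ (l + 1)))"
proof -
  have "poly (Polynomial.smult (a j l * fact l) ([:- x j, 1:] ^ (N j - 1 - l) * node_poly (J - {j}) x N)) z
      / poly (node_poly J x N) z = a j l * (fact l / (z - x j) ^ (l + 1))"
    if j: "j \<in> J" and l: "l < N j" for j l
  proof -
    have "z - x j \<noteq> 0" "poly (node_poly (J - {j}) x N) z \<noteq> 0"
      using z j assms(1) by (auto simp: poly_node_poly)
    moreover have "(z - x j) ^ N j = (z - x j) ^ (N j - 1 - l) * (z - x j) ^ (l + 1)"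
      using l by (subst power_add[symmetric]) simp
    ultimately show ?thesis
      by (simp add: node_poly_split[OF assms(1) j] poly_power)
  qed
  thus ?thesis
    by (simp add: rat_fun_def pade_numerator_def poly_sum sum_divide_distrib)
qed

lemma pade_solution_of_signal:
  assumes sol: "prony_solution d m s D x a"
  shows "pade_solution d m (pade_numerator {..<s} x D a) (node_poly {..<s} x D)"
proof -
  define P Q where "P = pade_numerator {..<s} x D a" and "Q = node_poly {..<s} x D"
  have tail: "(\<lambda>z. \<Sum>j<s. \<Sum>l<D j. a j l * inverse_tail (2 * d) l (x j) z)
      \<in> O[at_infinity](\<lambda>z. 1 / z ^ (2 * d + 1))"
  proof (intro big_sum_in_bigo)
    fix j l
    show "(\<lambda>z. a j l * inverse_tail (2 * d) l (x j) z) \<in> O[at_infinity](\<lambda>z. 1 / z ^ (2 * d + 1))"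
      by (rule landau_o.big_trans[OF const_mult_bigo inverse_tail_bigo])
  qed
  have "\<forall>\<^sub>F z in at_infinity. rat_fun P Q z - (\<Sum>k<2 * d. m k / z ^ (k + 1)) =
      (\<Sum>j<s. \<Sum>l<D j. a j l * inverse_tail (2 * d) l (x j) z)"
  proof -
    have "\<forall>\<^sub>F z in at_infinity. \<forall>y\<in>x ` {..<s}. z \<noteq> y"
      by (intro eventually_ball_finite ballI eventually_at_infinity_neq) simp
    thus ?thesis
    proof eventually_elim
      case (elim z)
      have "(\<Sum>k<2 * d. m k / z ^ (k + 1)) =
          (\<Sum>k<2 * d. \<Sum>j<s. \<Sum>l<D j. a j l * (deriv_monom k l (x j) / z ^ (k + 1)))"
      proof (rule sum.cong)
        fix k assume "k \<in> {..<2 * d}"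
        hence "m k = (\<Sum>j<s. \<Sum>l<D j. a j l * deriv_monom k l (x j))"
          using sol by (simp add: prony_solution_def)
        thus "m k / z ^ (k + 1) = (\<Sum>j<s. \<Sum>l<D j. a j l * (deriv_monom k l (x j) / z ^ (k + 1)))"
          by (simp add: sum_divide_distrib)
      qed simp
      also have "\<dots> = (\<Sum>j<s. \<Sum>l<D j. \<Sum>k<2 * d. a j l * (deriv_monom k l (x j) / z ^ (k + 1)))"
        by (subst sum.swap, rule sum.cong[OF refl], rule sum.swap)
      finally show ?case
        unfolding P_def Q_def using elim
        by (subst rat_fun_pade_numerator)
          (auto simp: inverse_tail_def right_diff_distrib sum_subtractf sum_distrib_left)
    qed
  qed
  from landau_o.big.in_cong[OF this] tail
  have "(\<lambda>z. rat_fun P Q z - (\<Sum>k<2 * d. m k / z ^ (k + 1)))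
      \<in> O[at_infinity](\<lambda>z. 1 / z ^ (2 * d + 1))"
    by blast
  moreover have "degree Q \<le> d"
    using sol by (simp add: Q_def degree_node_poly prony_solution_def)
  ultimately show ?thesis
    using degree_pade_numerator[of "{..<s}" x D a]
    by (simp add: pade_solution_def P_def Q_def)
qed

lemma poly_bigo_power_degree:
  fixes p :: "complex poly"
  assumes "degree p \<le> n"
  shows "poly p \<in> O[at_infinity](\<lambda>z. z ^ n)"
proof -
  have "(\<lambda>z. \<Sum>i\<le>degree p. coeff p i * z ^ i) \<in> O[at_infinity](\<lambda>z. z ^ n)"
  proof (intro big_sum_in_bigo)
    fix i assume "i \<in> {..degree p}"
    hence "i \<le> n" using assms by simp
    have "(\<lambda>z::complex. z ^ i) \<in> O[at_infinity](\<lambda>z. z ^ n)"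
    proof (rule bigoI[of _ 1])
      have "norm (z ^ i) \<le> 1 * norm (z ^ n)" if "norm z \<ge> 1" for z :: complex
        using power_increasing[OF \<open>i \<le> n\<close> that] by (simp add: norm_power)
      thus "\<forall>\<^sub>F z in at_infinity. norm (z ^ i) \<le> 1 * norm (z ^ n :: complex)"
        unfolding eventually_at_infinity by blast
    qed
    thus "(\<lambda>z. coeff p i * z ^ i) \<in> O[at_infinity](\<lambda>z. z ^ n)"
      by (rule landau_o.big_trans[OF const_mult_bigo])
  qed
  thus ?thesis by (simp add: poly_altdef[abs_def])
qed

lemma poly_eq_0_of_bigo_inverse:
  fixes p :: "complex poly"
  assumes "poly p \<in> O[at_infinity](\<lambda>z. 1 / z)"
  shows "p = 0"
proof -
  have "((\<lambda>z::complex. 1 / z) \<longlongrightarrow> 0) at_infinity"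
    by (rule tendsto_divide_0[OF tendsto_const filterlim_ident])
  hence lim_c: "((\<lambda>z::complex. c * norm (1 / z)) \<longlongrightarrow> 0) at_infinity" for c
    by (intro tendsto_mult_right_zero tendsto_norm_zero)
  obtain c where "\<forall>\<^sub>F z in at_infinity. norm (poly p z) \<le> c * norm (1 / z)"
    using assms by (rule landau_o.bigE)
  hence lim: "(poly p \<longlongrightarrow> 0) at_infinity"
    using lim_c by (rule Lim_null_comparison)
  show ?thesis
  proof (cases "degree p = 0")
    case True
    then obtain c where "p = [:c:]" by (rule degree_eq_zeroE)
    moreover from this have "poly p = (\<lambda>_. c)"
      by auto
    ultimately show ?thesis
      using lim tendsto_unique[OF trivial_limit_at_infinity tendsto_const, of c 0] by simp
  next
    case False
    hence "filterlim (poly p) at_infinity at_infinity"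
      by (intro filterlim_poly_at_infinity) simp
    thus ?thesis
      using not_tendsto_and_filterlim_at_infinity[OF trivial_limit_at_infinity lim] by simp
  qed
qed

text \<open>The difference of the two rational functions is \<open>O(1 / z ^ (2 * d + 1))\<close>, and the product of the
  denominators has degree at most \<open>2 * d\<close>. So \<open>P * Q' - P' * Q\<close> is a polynomial in \<open>O(1 / z)\<close>.\<close>

lemma pade_solution_unique:
  assumes "pade_solution d m P Q" "pade_solution d m P' Q'"
  shows "P * Q' = P' * Q"
proof -
  let ?S = "\<lambda>z. \<Sum>k<2 * d. m k / z ^ (k + 1)"
  have Q: "Q \<noteq> 0" "Q' \<noteq> 0" "degree (Q * Q') \<le> 2 * d"
    using assms by (auto simp: pade_solution_def degree_mult_eq)
  have "(\<lambda>z. (rat_fun P Q z - ?S z) - (rat_fun P' Q' z - ?S z)) \<in> O[at_infinity](\<lambda>z. 1 / z ^ (2 * d + 1))"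
    by (rule sum_in_bigo(2)) (use assms in \<open>unfold pade_solution_def, blast+\<close>)
  hence "(\<lambda>z. ((rat_fun P Q z - ?S z) - (rat_fun P' Q' z - ?S z)) * poly (Q * Q') z)
      \<in> O[at_infinity](\<lambda>z. 1 / z ^ (2 * d + 1) * z ^ (2 * d))"
    using poly_bigo_power_degree[OF Q(3)] by (rule landau_o.big.mult)
  also have "?this \<longleftrightarrow> poly (P * Q' - P' * Q) \<in> O[at_infinity](\<lambda>z. 1 / z)"
  proof (rule landau_o.big.cong_ex)
    have "\<forall>\<^sub>F z in at_infinity. \<forall>y\<in>{y. poly (Q * Q') y = 0}. z \<noteq> y"
      using Q(1,2) by (intro eventually_ball_finite ballI eventually_at_infinity_neq poly_roots_finite) auto
    thus "\<forall>\<^sub>F z in at_infinity. ((rat_fun P Q z - ?S z) - (rat_fun P' Q' z - ?S z)) * poly (Q * Q') z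
        = poly (P * Q' - P' * Q) z"
      by eventually_elim (auto simp: rat_fun_def field_simps)
    show "\<forall>\<^sub>F z::complex in at_infinity. 1 / z ^ (2 * d + 1) * z ^ (2 * d) = 1 / z"
      using eventually_at_infinity_neq[of 0] by eventually_elim simp
  qed
  finally show ?thesis
    using poly_eq_0_of_bigo_inverse by force
qed

text \<open>At \<open>x j\<close> all summands vanish except the one with the highest power of \<open>z - x j\<close> in its denominator,
  which is that of the leading coefficient.\<close>

lemma pade_numerator_node_nonzero:
  assumes fin: "finite J" and inj: "inj_on x J" and j: "j \<in> J" and N: "\<And>i. i \<in> J \<Longrightarrow> 0 < N i"
    and a: "a j (N j - 1) \<noteq> 0"
  shows "poly (pade_numerator J x N a) (x j) \<noteq> 0"
proof -
  let ?t = "\<lambda>i l. a i l * fact l * ((x j - x i) ^ (N i - 1 - l) * poly (node_poly (J - {i}) x N) (x j))"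
  have other: "(\<Sum>l<N i. ?t i l) = 0" if "i \<in> J - {j}" for i
  proof -
    have "poly (node_poly (J - {i}) x N) (x j) = 0"
      using fin j that N[OF j] by (auto simp: poly_node_poly intro!: prod_zero)
    thus ?thesis by simp
  qed
  have "poly (pade_numerator J x N a) (x j) = (\<Sum>i\<in>J. \<Sum>l<N i. ?t i l)"
    by (simp add: pade_numerator_def poly_sum poly_power)
  also have "\<dots> = (\<Sum>l<N j. ?t j l)"
    using fin j other by (simp add: sum.remove)
  also have "\<dots> = (\<Sum>l\<in>{N j - 1}. ?t j l)"
    by (rule sum.mono_neutral_right) (use N[OF j] in auto)
  also have "\<dots> = a j (N j - 1) * fact (N j - 1) * poly (node_poly (J - {j}) x N) (x j)"
    by simp
  finally show ?thesis
    using a poly_node_poly_Diff_nonzero[OF fin inj j, of N] by simp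
qed

text \<open>After the factor \<open>(z - x j) ^ N j\<close> is split off, the remaining quotient is holomorphic and non-zero
  near \<open>x j\<close>.\<close>

lemma rat_fun_poles:
  assumes fin: "finite J" and inj: "inj_on x J" and N: "\<And>j. j \<in> J \<Longrightarrow> 0 < N j"
    and P: "\<And>j. j \<in> J \<Longrightarrow> poly P (x j) \<noteq> 0"
  shows "{z. is_pole (rat_fun P (node_poly J x N)) z} = x ` J"
    and "j \<in> J \<Longrightarrow> zorder (rat_fun P (node_poly J x N)) (x j) = - int (N j)"
proof -
  define f where "f = rat_fun P (node_poly J x N)"
  have node: "is_pole f (x j) \<and> zorder f (x j) = - int (N j)" if j: "j \<in> J" for j
  proof -
    define g where "g = (\<lambda>z. poly P z / poly (node_poly (J - {j}) x N) z)"
    define A where "A = - x ` (J - {j})"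
    have f: "f = (\<lambda>z. g z / (z - x j) ^ N j)"
      by (auto simp: f_def rat_fun_def g_def node_poly_split[OF fin j] poly_power mult.commute)
    have A: "open A" "x j \<in> A"
      using fin inj j by (auto simp: A_def open_Compl finite_imp_closed inj_on_def)
    have g: "g holomorphic_on A" "g (x j) \<noteq> 0"
      unfolding g_def using fin P[OF j] poly_node_poly_Diff_nonzero[OF fin inj j, of N]
      by (auto intro!: holomorphic_intros simp: A_def poly_node_poly)
    have "is_pole f (x j)"
      unfolding f using g A N[OF j] by (intro is_pole_basic)
    moreover have "zorder f (x j) = - int (N j)"
      by (rule zorder_eqI[OF A g]) (simp add: f power_int_minus field_simps)
    ultimately show ?thesis ..
  qed
  have "\<not> is_pole f z" if "z \<notin> x ` J" for z
  proof (rule not_is_pole_holomorphic)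
    show "open (- x ` J)"
      using fin by (simp add: open_Compl finite_imp_closed)
    show "f holomorphic_on - x ` J"
      unfolding f_def rat_fun_def using fin by (auto intro!: holomorphic_intros simp: poly_node_poly)
  qed (use that in simp)
  thus "{z. is_pole (rat_fun P (node_poly J x N)) z} = x ` J"
    using node by (auto simp: f_def)
  show "j \<in> J \<Longrightarrow> zorder (rat_fun P (node_poly J x N)) (x j) = - int (N j)"
    using node by (simp add: f_def)
qed

theorem theorem3p6:
  fixes d r :: nat and m :: "nat \<Rightarrow> complex"
  assumes "d \<ge> 1"
    and "r = vec_space.rank d (hankel m d (d + 1))"
  shows
    "((\<exists>s D x a. prony_solution d m s D x a) \<longleftrightarrow> Determinant.det (hankel m r r) \<noteq> 0) \<and>
     (\<forall>s D x a s' D' x' a'.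
        prony_solution d m s D x a \<longrightarrow> prony_solution d m s' D' x' a' \<longrightarrow>
        same_signal s D x a s' D' x' a') \<and>
     (\<forall>s D x a. prony_solution d m s D x a \<longrightarrow>
        (\<Sum>j<s. D j) = r \<and>
        (\<exists>P Q. pade_solution d m P Q \<and>
           (\<forall>P' Q'. pade_solution d m P' Q' \<longrightarrow> P * Q' = P' * Q) \<and>
           pole_multiplicity_vector (rat_fun P Q) s D))"
proof (intro conjI allI impI)
  show "(\<exists>s D x a. prony_solution d m s D x a) \<longleftrightarrow> Determinant.det (hankel m r r) \<noteq> 0"
    using prony_solution_imp_det_rank prony_solution_exists assms(2) by metis
next
  fix s D x a s' D' x' a'
  assume "prony_solution d m s D x a" "prony_solution d m s' D' x' a'"
  thus "same_signal s D x a s' D' x' a'"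
    by (rule prony_solution_unique)
next
  fix s D x a
  assume sol: "prony_solution d m s D x a"
  show "(\<Sum>j<s. D j) = r"
    using prony_solution_imp_det_rank(2)[OF sol] assms(2) by simp
  define P Q where "P = pade_numerator {..<s} x D a" and "Q = node_poly {..<s} x D"
  have signal: "inj_on x {..<s}" "\<And>j. j \<in> {..<s} \<Longrightarrow> 0 < D j" "\<And>j. j \<in> {..<s} \<Longrightarrow> a j (D j - 1) \<noteq> 0"
    using sol by (auto simp: prony_solution_def)
  have pade: "pade_solution d m P Q"
    unfolding P_def Q_def using sol by (rule pade_solution_of_signal)
  have num: "poly P (x j) \<noteq> 0" if "j \<in> {..<s}" for j
    unfolding P_def using signal that by (intro pade_numerator_node_nonzero) auto
  have "{z. is_pole (rat_fun P Q) z} = x ` {..<s}"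
    unfolding Q_def by (rule rat_fun_poles(1)[OF finite_lessThan signal(1)]) (use signal num in auto)
  moreover have "zorder (rat_fun P Q) (x j) = - int (D j)" if "j < s" for j
    unfolding Q_def
    by (rule rat_fun_poles(2)[OF finite_lessThan signal(1)]) (use signal num that in auto)
  ultimately have "pole_multiplicity_vector (rat_fun P Q) s D"
    unfolding pole_multiplicity_vector_def
    using signal(1) by (intro exI[of _ x]) (auto simp: bij_betw_def)
  thus "\<exists>P Q. pade_solution d m P Q \<and>
      (\<forall>P' Q'. pade_solution d m P' Q' \<longrightarrow> P * Q' = P' * Q) \<and>
      pole_multiplicity_vector (rat_fun P Q) s D"
    using pade pade_solution_unique by blast
qed

end
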